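(* Let $\kappa$ be an ineffable cardinal. If ${\sf BC}_\lambda$ holds for every infinite cardinal $\lambda<\kappa$, then ${\sf BC}_\kappa$ holds.
   Context: An uncountable regular cardinal $\kappa$ is ineffable if for every sequence $(A_\alpha:\alpha<\kappa)$ with $A_\alpha\subseteq\alpha$ there is $A\subseteq\kappa$ such that $\{\alpha<\kappa:A_\alpha=A\cap\alpha\}$ is stationary. All topological groups are assumed Tychonoff. A topological group $(G,* )$ is $\aleph_0$-bounded if for every open neighborhood $U$ of the identity countably many translates of $U$ cover $G$. A subset $X$ of $G$ is Rothberger bounded if for every sequence $(U_n:n<\omega)$ of open neighborhoods of the identity there are $g_n\in G$ with $X\subseteq\bigcup_n g_n*U_n$. For infinite $\lambda$, ${\sf BC}_\lambda$: every Rothberger bounded subset of an $\aleph_0$-bounded topological group of weight $\lambda$ has cardinality at most $\lambda$. *)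

theory Defs
  imports "HOL-Analysis.Analysis" "HOL-Algebra.Coset"
begin

text \<open>A cardinal kappa is represented by a cardinal well-order r (Card_order r);
  the ordinals below kappa are the elements of Field r, and the ordinal alpha viewed
  as a set of smaller ordinals is underS r alpha.\<close>

definition club :: "'k rel \<Rightarrow> 'k set \<Rightarrow> bool" where
  "club r C \<longleftrightarrow> C \<subseteq> Field r
     \<and> (\<forall>a\<in>Field r. \<exists>b\<in>C. b \<noteq> a \<and> (a, b) \<in> r)
     \<and> (\<forall>a\<in>Field r. C \<inter> underS r a \<noteq> {}
           \<and> (\<forall>b\<in>underS r a. \<exists>c\<in>C \<inter> underS r a. b \<noteq> c \<and> (b, c) \<in> r)
           \<longrightarrow> a \<in> C)"

definition stationary :: "'k rel \<Rightarrow> 'k set \<Rightarrow> bool" where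
  "stationary r S \<longleftrightarrow> S \<subseteq> Field r \<and> (\<forall>C. club r C \<longrightarrow> S \<inter> C \<noteq> {})"

definition ineffable :: "'k rel \<Rightarrow> bool" where
  "ineffable r \<longleftrightarrow> Card_order r \<and> \<not> countable (Field r) \<and> regularCard r
     \<and> (\<forall>A :: 'k \<Rightarrow> 'k set. (\<forall>a\<in>Field r. A a \<subseteq> underS r a) \<longrightarrow>
          (\<exists>B \<subseteq> Field r. stationary r {a \<in> Field r. A a = B \<inter> underS r a}))"

definition topological_group :: "'a monoid \<Rightarrow> 'a topology \<Rightarrow> bool" where
  "topological_group G T \<longleftrightarrow> group G \<and> topspace T = carrier G
     \<and> continuous_map (prod_topology T T) T (\<lambda>(x, y). x \<otimes>\<^bsub>G\<^esub> y)
     \<and> continuous_map T T (\<lambda>x. inv\<^bsub>G\<^esub> x)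
     \<and> completely_regular_space T \<and> t1_space T"

definition aleph0_bounded :: "'a monoid \<Rightarrow> 'a topology \<Rightarrow> bool" where
  "aleph0_bounded G T \<longleftrightarrow> (\<forall>U. openin T U \<and> \<one>\<^bsub>G\<^esub> \<in> U \<longrightarrow>
      (\<exists>C. countable C \<and> C \<subseteq> carrier G \<and> carrier G \<subseteq> (\<Union>c\<in>C. c <#\<^bsub>G\<^esub> U)))"

definition rothberger_bounded :: "'a monoid \<Rightarrow> 'a topology \<Rightarrow> 'a set \<Rightarrow> bool" where
  "rothberger_bounded G T X \<longleftrightarrow> X \<subseteq> carrier G \<and>
     (\<forall>U :: nat \<Rightarrow> 'a set. (\<forall>n. openin T (U n) \<and> \<one>\<^bsub>G\<^esub> \<in> U n) \<longrightarrow>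
        (\<exists>g :: nat \<Rightarrow> 'a. (\<forall>n. g n \<in> carrier G) \<and> X \<subseteq> (\<Union>n. g n <#\<^bsub>G\<^esub> U n)))"

definition is_base :: "'a topology \<Rightarrow> 'a set set \<Rightarrow> bool" where
  "is_base T \<B> \<longleftrightarrow> (\<forall>V\<in>\<B>. openin T V) \<and>
     (\<forall>U x. openin T U \<and> x \<in> U \<longrightarrow> (\<exists>V\<in>\<B>. x \<in> V \<and> V \<subseteq> U))"

definition has_weight :: "'a topology \<Rightarrow> 'b set \<Rightarrow> bool" where
  "has_weight T L \<longleftrightarrow> (\<exists>\<B>. is_base T \<B> \<and> (card_of \<B>, card_of L) \<in> ordLeq)
     \<and> (\<forall>\<B>. is_base T \<B> \<longrightarrow> (card_of L, card_of \<B>) \<in> ordLeq)"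

definition BC :: "'a itself \<Rightarrow> 'b set \<Rightarrow> bool" where
  "BC (_ :: 'a itself) L \<longleftrightarrow>
     (\<forall>(G :: 'a monoid) T X. topological_group G T \<and> aleph0_bounded G T \<and> has_weight T L
        \<and> rothberger_bounded G T X \<longrightarrow> (card_of X, card_of L) \<in> ordLeq)"

end

theory Submission
  imports Defs "HOL-Library.Equipollence" "HOL-Algebra.Weak_Morphisms"
begin

text \<open>Let \<open>X\<close> be Rothberger bounded in \<open>G\<close>. Choose \<open>\<kappa>\<close> many neighbourhoods \<open>U b\<close> of the identity that
  separate points. For \<open>a < \<kappa>\<close>, closing \<open>{U b | b < a}\<close> under intersections, halving and the countably
  many conjugates provided by \<open>\<aleph>\<^sub>0\<close>-boundedness gives at most \<open>|a|\<close> neighbourhoods, which define a Tychonoff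
  quotient group of weight at most \<open>|a|\<close>. By the hypothesis below \<open>\<kappa>\<close>, the image of \<open>X\<close> there has size at
  most \<open>|a|\<close>. The images form a tree of height \<open>\<kappa>\<close> whose level \<open>a\<close> has at most \<open>|a|\<close> nodes and whose
  branches include the points of \<open>X\<close>; ineffability leaves room for at most \<open>\<kappa>\<close> such branches.\<close>

text \<open>The smaller instances of \<open>BC\<close> speak of weight, so \<open>X\<close> has to
  be viewed in groups whose topology comes from few neighbourhoods. Conjugation is the obstacle:
  closing under all conjugates could cost as many sets as \<open>G\<close> has elements. The choices
  of halves and conjugates are made once for all levels, so the filter bases increase with
  \<open>a\<close> and the images fit together into a tree. As level \<open>a\<close> has at most
  |a| nodes, these can be numbered by ordinals below \<open>a\<close>. The numbering is then
  regressive, and a subset of \<open>a\<close> can record all numbers at lower levels, which is the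
  form that ineffability guesses. Two frictions remain. The smaller instances are available only for
  groups with elements of type \<open>'k set\<close>, so each quotient has to be copied into that
  type. They also concern the exact, infinite weight, whereas the weight of a quotient may drop
  below |a| and even be finite.\<close>

lemma lepoll_iff_card_of: "A \<lesssim> B \<longleftrightarrow> (card_of A, card_of B) \<in> ordLeq"
  by (simp add: lepoll_def card_of_ordLeq)

lemma lepoll_Times_infinite:
  assumes "infinite C" "A \<lesssim> C" "B \<lesssim> C"
  shows "A \<times> B \<lesssim> C"
  using assms card_of_Times_ordLeq_infinite_Field[of "card_of C" A B]
  by (simp add: lepoll_iff_card_of card_of_card_order_on Field_card_of)

lemma lepoll_UNION_infinite:
  assumes "infinite C" "I \<lesssim> C" "\<And>i. i \<in> I \<Longrightarrow> A i \<lesssim> C"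
  shows "(\<Union>i\<in>I. A i) \<lesssim> C"
  using assms card_of_UNION_ordLeq_infinite[of C I A] by (simp add: lepoll_iff_card_of)

section \<open>Ineffable cardinals have no thin trees with many branches\<close>

locale regular_cardinal =
  fixes r :: "'k rel"
  assumes Card: "Card_order r" and regular: "regularCard r" and uncountable: "\<not> countable (Field r)"
begin

sublocale wo: wo_rel r
  using Card by unfold_locales (simp add: card_order_on_def)

lemma infinite_Field: "infinite (Field r)"
  using uncountable countable_finite by blast

lemma underS_Field: "x \<in> underS r a \<Longrightarrow> x \<in> Field r \<and> a \<in> Field r"
  by (auto simp: underS_def Field_def)

lemma underS_trans: "x \<in> underS r y \<Longrightarrow> y \<in> underS r z \<Longrightarrow> x \<in> underS r z"
  using wo.TRANS wo.ANTISYM by (auto simp: underS_def trans_def antisym_def)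

lemma underS_linear:
  "x \<in> Field r \<Longrightarrow> y \<in> Field r \<Longrightarrow> x \<in> underS r y \<or> x = y \<or> y \<in> underS r x"
  using wo.TOTALS by (auto simp: underS_def)

lemma under_iff: "x \<in> under r a \<longleftrightarrow> x \<in> underS r a \<or> x = a \<and> a \<in> Field r"
  using wo.TOTALS by (auto simp: underS_def under_def Field_def)

text \<open>A set that is not cofinal lies weakly below some \<open>a\<close>; an infinite cardinal
  is a limit, so one step further the bound is strict.\<close>

lemma strict_upper_bound:
  assumes "K \<subseteq> Field r" "(card_of K, r) \<in> ordLess"
  obtains b where "b \<in> Field r" "K \<subseteq> underS r b"
proof -
  have "\<not> cofinal K r"
    using assms regular not_ordLess_ordIso unfolding regularCard_def by blast
  then obtain a where a: "a \<in> Field r" "\<forall>b\<in>K. a = b \<or> (a, b) \<notin> r"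
    unfolding cofinal_def by auto
  obtain b where b: "b \<in> Field r" "a \<noteq> b" "(a, b) \<in> r"
    using infinite_Card_order_limit[OF Card infinite_Field a(1)] by auto
  have "x \<in> underS r b" if "x \<in> K" for x
  proof -
    have "x = a \<or> x \<in> underS r a"
      using a that assms(1) underS_linear[of x a] by (auto simp: underS_def)
    moreover have "a \<in> underS r b" using b by (simp add: underS_def)
    ultimately show ?thesis using underS_trans by blast
  qed
  then show thesis using that b(1) by blast
qed

lemma lepoll_underS_less:
  assumes "a \<in> Field r" "K \<lesssim> underS r a"
  shows "(card_of K, r) \<in> ordLess"
  using assms card_of_underS[OF Card] ordLeq_ordLess_trans unfolding lepoll_iff_card_of by blast

lemma countable_less: "countable K \<Longrightarrow> (card_of K, r) \<in> ordLess"
proof -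
  assume K: "countable K"
  have "\<not> Field r \<lesssim> K"
    using K uncountable by (meson countable_lepoll)
  then have "(card_of K, card_of (Field r)) \<in> ordLess"
    unfolding lepoll_def by (simp flip: card_of_ordLess)
  then show ?thesis
    using card_of_Field_ordIso[OF Card] ordLess_ordIso_trans by blast
qed

lemma finite_strict_upper_bound:
  assumes "finite K" "K \<subseteq> Field r"
  shows "\<exists>b\<in>Field r. K \<subseteq> underS r b"
  using strict_upper_bound[OF assms(2) countable_less[OF countable_finite[OF assms(1)]]] by blast

lemma infinite_underS_exists: obtains a where "a \<in> Field r" "infinite (underS r a)"
proof -
  obtain K where K: "K \<subseteq> Field r" "countable K" "infinite K"
    using infinite_countable_subset'[OF infinite_Field] by auto
  obtain b where "b \<in> Field r" "K \<subseteq> underS r b"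
    using strict_upper_bound[OF K(1) countable_less[OF K(2)]] .
  then show thesis using that K(3) finite_subset by blast
qed

definition closed_under :: "('k \<Rightarrow> 'k) \<Rightarrow> 'k \<Rightarrow> bool"
  where "closed_under h a \<longleftrightarrow> (\<forall>x\<in>underS r a. h x \<in> underS r a)"

text \<open>An iteration of length omega: from \<open>a\<close>, pass repeatedly to a point bounding
  the values of \<open>h\<close> on the whole initial segment reached so far. Regularity bounds each
  step and, with uncountability, the whole sequence.\<close>

lemma club_closed_under:
  assumes h: "\<And>x. x \<in> Field r \<Longrightarrow> h x \<in> Field r" and a0: "a0 \<in> Field r"
  shows "club r {a \<in> Field r. a0 \<in> underS r a \<and> closed_under h a}" (is "club r ?C")
  unfolding club_def
proof (intro conjI ballI impI)
  show "?C \<subseteq> Field r" by auto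
next
  fix a assume a: "a \<in> Field r"
  \<comment> \<open>\<open>h\<close> need not be monotone, hence the image of the entire segment
    \<open>under r x\<close> instead of \<open>h x\<close> alone.\<close>
  have "\<exists>c \<in> Field r. insert x (insert a0 (h ` under r x)) \<subseteq> underS r c" if x: "x \<in> Field r" for x
  proof -
    have "(card_of (under r x), r) \<in> ordLess"
    proof -
      obtain y where y: "y \<in> Field r" "x \<noteq> y" "(x, y) \<in> r"
        using infinite_Card_order_limit[OF Card infinite_Field x] by auto
      then have "under r x \<subseteq> underS r y"
        using underS_trans[of _ x y] by (auto simp: under_iff) (auto simp: underS_def)
      then show ?thesis
        using y(1) lepoll_underS_less subset_imp_lepoll by blast
    qed
    then have "(card_of (h ` under r x), r) \<in> ordLess"
      using card_of_image ordLeq_ordLess_trans by blast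
    moreover have "h ` under r x \<subseteq> Field r" using h by (auto simp: under_def Field_def)
    ultimately obtain b where b: "b \<in> Field r" "h ` under r x \<subseteq> underS r b"
      using strict_upper_bound by blast
    obtain c where c: "c \<in> Field r" "{b, a0, x} \<subseteq> underS r c"
      using finite_strict_upper_bound[of "{b, a0, x}"] b(1) a0 x by auto
    then show ?thesis using b underS_trans by blast
  qed
  then obtain g where g: "\<And>x. x \<in> Field r \<Longrightarrow> g x \<in> Field r"
    "\<And>x. x \<in> Field r \<Longrightarrow> insert x (insert a0 (h ` under r x)) \<subseteq> underS r (g x)"
    by metis
  define s where "s n = (g ^^ n) a" for n
  have s: "s n \<in> Field r" for n
    by (induction n) (auto simp: s_def a g(1))
  have step: "insert (s n) (insert a0 (h ` under r (s n))) \<subseteq> underS r (s (Suc n))" for n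
    using g(2)[OF s[of n]] by (simp add: s_def)
  define B where "B = {b \<in> Field r. range s \<subseteq> underS r b}"
  have "range s \<subseteq> Field r" using s by blast
  then obtain u where "u \<in> Field r" "range s \<subseteq> underS r u"
    using countable_less[of "range s"] by (elim strict_upper_bound) simp_all
  then have "B \<noteq> {}" by (auto simp: B_def)
  \<comment> \<open>The least bound, so that every \<open>x\<close> below \<open>b\<close> is at or
    below some \<open>s n\<close>.\<close>
  define b where "b = wo.minim B"
  have "b \<in> B"
    unfolding b_def using \<open>B \<noteq> {}\<close> by (intro wo.minim_in) (auto simp: B_def)
  then have b: "b \<in> Field r" "\<And>n. s n \<in> underS r b"
    by (auto simp: B_def)
  have "h x \<in> underS r b" if x: "x \<in> underS r b" for x
  proof -
    have "x \<notin> B"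
    proof
      assume "x \<in> B"
      then have "(b, x) \<in> r" unfolding b_def by (intro wo.minim_least) (auto simp: B_def)
      then show False using x wo.ANTISYM by (auto simp: underS_def antisym_def)
    qed
    moreover have xF: "x \<in> Field r" using x underS_Field by blast
    ultimately obtain n where "s n \<notin> underS r x"
      by (auto simp: B_def)
    then have "x \<in> under r (s n)"
      using underS_linear[OF xF s[of n]] s[of n] by (auto simp: under_iff)
    then have "h x \<in> underS r (s (Suc n))" using step[of n] by blast
    then show ?thesis using b(2)[of "Suc n"] by (rule underS_trans)
  qed
  moreover have "a0 \<in> underS r b"
    using step[of 0] underS_trans[OF _ b(2)[of "Suc 0"]] by simp
  ultimately have bC: "b \<in> ?C" using b(1) by (auto simp: closed_under_def)
  have "a \<in> underS r b" using b(2)[of 0] by (simp add: s_def)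
  then have "b \<noteq> a \<and> (a, b) \<in> r" by (auto simp: underS_def)
  then show "\<exists>b\<in>?C. b \<noteq> a \<and> (a, b) \<in> r" using bC by (rule bexI)
next
  fix a assume a: "a \<in> Field r"
    and lim: "?C \<inter> underS r a \<noteq> {} \<and> (\<forall>b\<in>underS r a. \<exists>c\<in>?C \<inter> underS r a. b \<noteq> c \<and> (b, c) \<in> r)"
  have "h x \<in> underS r a" if "x \<in> underS r a" for x
  proof -
    from bspec[OF conjunct2[OF lim] that]
    obtain c where "c \<in> ?C \<inter> underS r a" "x \<noteq> c \<and> (x, c) \<in> r"
      by (rule bexE)
    then have "c \<in> ?C" "c \<in> underS r a" "x \<in> underS r c"
      by (simp_all add: underS_def)
    then have "h x \<in> underS r c" by (simp add: closed_under_def)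
    then show ?thesis using \<open>c \<in> underS r a\<close> by (rule underS_trans)
  qed
  moreover have "a0 \<in> underS r a"
  proof -
    from conjunct1[OF lim] obtain c where "c \<in> underS r a" "a0 \<in> underS r c" by auto
    then show ?thesis using underS_trans by blast
  qed
  ultimately show "a \<in> ?C" using a by (auto simp: closed_under_def)
qed

text \<open>A weak form of Fodor's lemma: the fibre is only claimed to be unbounded, so no diagonal
  intersections are needed.\<close>

lemma regressive_unbounded_fibre:
  assumes S: "stationary r S" and h: "\<And>x. x \<in> Field r \<Longrightarrow> h x \<in> Field r" and a0: "a0 \<in> Field r"
    and f: "\<And>a. a \<in> S \<Longrightarrow> a0 \<in> underS r a \<Longrightarrow> f a \<in> underS r a"
  obtains c where "c \<in> Field r"
    "\<And>g. g \<in> Field r \<Longrightarrow> \<exists>a\<in>S. g \<in> underS r a \<and> a0 \<in> underS r a \<and> closed_under h a \<and> f a = c"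
proof -
  have False
    if no_fibre: "\<forall>c\<in>Field r. \<exists>g\<in>Field r. \<forall>a\<in>S. g \<in> underS r a \<and> a0 \<in> underS r a \<and> closed_under h a \<longrightarrow> f a \<noteq> c"
  proof -
    obtain g where g: "\<And>c. c \<in> Field r \<Longrightarrow> g c \<in> Field r"
      "\<And>c a. c \<in> Field r \<Longrightarrow> a \<in> S \<Longrightarrow> g c \<in> underS r a \<Longrightarrow> a0 \<in> underS r a \<Longrightarrow> closed_under h a \<Longrightarrow> f a \<noteq> c"
      using no_fibre by metis
    have "\<exists>m\<in>Field r. g c \<in> underS r m \<and> h c \<in> underS r m" if "c \<in> Field r" for c
      using finite_strict_upper_bound[of "{g c, h c}"] g(1) h that by auto
    \<comment> \<open>One function dominates both \<open>h\<close> and the bounds \<open>g\<close>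
      of the fibres. At a closure point \<open>a\<close> of \<open>m\<close> in \<open>S\<close>,
      the value \<open>f a\<close> lies below \<open>a\<close>, hence so does
      \<open>g (f a)\<close>, and this forbids the value \<open>f a\<close> at
      \<open>a\<close>.\<close>
    then obtain m where m: "\<And>c. c \<in> Field r \<Longrightarrow> m c \<in> Field r"
      "\<And>c. c \<in> Field r \<Longrightarrow> g c \<in> underS r (m c) \<and> h c \<in> underS r (m c)"
      by metis
    obtain a where a: "a \<in> S" "a0 \<in> underS r a" "closed_under m a"
      using S club_closed_under[of m a0, OF m(1) a0] unfolding stationary_def by blast
    have less: "h x \<in> underS r a \<and> g x \<in> underS r a" if "x \<in> underS r a" for x
      using that m(2)[of x] a(3) underS_Field underS_trans unfolding closed_under_def by meson
    then have "closed_under h a" by (simp add: closed_under_def)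
    moreover have "f a \<in> underS r a" using f a by blast
    ultimately show False using g(2)[of "f a" a] less a underS_Field by blast
  qed
  then show thesis using that by metis
qed

end

text \<open>Think of \<open>F x a\<close> as a number below \<open>a\<close> for the restriction of the branch \<open>x\<close> to
  level \<open>a\<close>. Ineffability guesses coherently, for stationarily many levels \<open>a\<close>, the whole set of
  branches below \<open>a\<close>; a branch is then determined by a number that it gets unboundedly often.\<close>

lemma ineffable_thin_branches:
  fixes r :: "'k rel" and F :: "'x \<Rightarrow> 'k \<Rightarrow> 'k"
  assumes ineff: "ineffable r" and a0: "a0 \<in> Field r"
    and regr: "\<And>x a. x \<in> X \<Longrightarrow> a0 \<in> underS r a \<Longrightarrow> F x a \<in> underS r a"
    and coh: "\<And>x y a b. x \<in> X \<Longrightarrow> y \<in> X \<Longrightarrow> a0 \<in> underS r b \<Longrightarrow> b \<in> underS r a \<Longrightarrow>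
               F x a = F y a \<Longrightarrow> F x b = F y b"
    and sep: "\<And>x y. x \<in> X \<Longrightarrow> y \<in> X \<Longrightarrow> x \<noteq> y \<Longrightarrow> \<exists>a. a0 \<in> underS r a \<and> F x a \<noteq> F y a"
  shows "X \<lesssim> Field r"
proof -
  interpret regular_cardinal r
    using ineff by unfold_locales (auto simp: ineffable_def)
  let ?F = "Field r"
  have "?F \<times> ?F \<times> ?F \<lesssim> ?F"
    by (intro lepoll_Times_infinite infinite_Field lepoll_refl)
  then obtain p where p: "inj_on p (?F \<times> ?F \<times> ?F)" "p ` (?F \<times> ?F \<times> ?F) \<subseteq> ?F"
    unfolding lepoll_def by auto
  \<comment> \<open>\<open>h\<close> will bound the codes of triples up to \<open>x\<close>, so its
    closure points are closed under \<open>p\<close>. The level \<open>y\<close> is raised until it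
    is infinite, so that triples are no more numerous than the points below it.\<close>
  have "\<exists>m \<in> ?F. p ` (under r x \<times> under r x \<times> under r x) \<subseteq> underS r m" if x: "x \<in> ?F" for x
  proof -
    obtain y where y: "y \<in> Field r" "x \<in> underS r y" "infinite (underS r y)"
    proof -
      obtain z where z: "z \<in> ?F" "infinite (underS r z)" using infinite_underS_exists .
      obtain y where y: "y \<in> ?F" "{x, z} \<subseteq> underS r y"
        using finite_strict_upper_bound[of "{x, z}"] x z by auto
      then have "underS r z \<subseteq> underS r y" using underS_trans by auto
      then show thesis using that[of y] y z(2) finite_subset by auto
    qed
    have sub: "under r x \<subseteq> underS r y"
      using y(2) underS_trans[of _ x y] by (auto simp: under_iff)
    have "under r x \<times> under r x \<times> under r x \<lesssim> underS r y"
      by (intro lepoll_Times_infinite y(3) subset_imp_lepoll[OF sub])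
    then have "p ` (under r x \<times> under r x \<times> under r x) \<lesssim> underS r y"
      using image_lepoll lepoll_trans by blast
    moreover have "p ` (under r x \<times> under r x \<times> under r x) \<subseteq> ?F"
    proof -
      have "under r x \<subseteq> ?F" by (auto simp: under_def Field_def)
      then show ?thesis using p(2) by blast
    qed
    ultimately show ?thesis
      using strict_upper_bound lepoll_underS_less[OF y(1)] by metis
  qed
  then obtain h where h: "\<And>x. x \<in> ?F \<Longrightarrow> h x \<in> ?F"
    "\<And>x. x \<in> ?F \<Longrightarrow> p ` (under r x \<times> under r x \<times> under r x) \<subseteq> underS r (h x)"
    by metis
  have p_closed: "p (x, y, z) \<in> underS r a"
    if "closed_under h a" and xyz: "x \<in> underS r a" "y \<in> underS r a" "z \<in> underS r a" for a x y z
  proof -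
    have F3: "x \<in> ?F" "y \<in> ?F" "z \<in> ?F" using xyz underS_Field by auto
    obtain m where m: "m \<in> underS r a" "x \<in> under r m" "y \<in> under r m" "z \<in> under r m"
    proof -
      have max: "\<exists>m\<in>{u, v}. u \<in> under r m \<and> v \<in> under r m" if "u \<in> ?F" "v \<in> ?F" for u v
        using that wo.TOTALS by (auto simp: under_def)
      obtain n where n: "n \<in> {x, y}" "x \<in> under r n" "y \<in> under r n"
        using max[OF F3(1,2)] by blast
      then have "n \<in> ?F" using F3 by blast
      then obtain m where m: "m \<in> {n, z}" "n \<in> under r m" "z \<in> under r m"
        using max[OF _ F3(3)] by blast
      have "x \<in> under r m" "y \<in> under r m"
        using n m(2) wo.TRANS by (auto simp: under_def trans_def)
      then show thesis using that[of m] m n xyz by auto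
    qed
    then have "p (x, y, z) \<in> underS r (h m)" using h(2)[of m] underS_Field by blast
    moreover have "h m \<in> underS r a" using that(1) m by (simp add: closed_under_def)
    ultimately show ?thesis using underS_trans by blast
  qed
  \<comment> \<open>The triple \<open>(i, b, j)\<close> says that a branch numbered \<open>i\<close>
    at level \<open>a\<close> has number \<open>j\<close> at level \<open>b\<close>. Cutting down to
    \<open>underS r a\<close> loses nothing at closure points of \<open>h\<close>.\<close>
  define A where "A a = {p (F x a, b, F x b) | x b. x \<in> X \<and> a0 \<in> underS r a \<and> a0 \<in> underS r b \<and> b \<in> underS r a}
    \<inter> underS r a" for a
  have "\<forall>a\<in>?F. A a \<subseteq> underS r a" by (auto simp: A_def)
  then obtain B where "stationary r {a \<in> ?F. A a = B \<inter> underS r a}"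
    using ineff unfolding ineffable_def by metis
  then obtain S where S: "stationary r S" "\<And>a. a \<in> S \<Longrightarrow> A a = B \<inter> underS r a"
    by auto
  have "\<exists>c\<in>?F. \<forall>g\<in>?F. \<exists>a\<in>S. g \<in> underS r a \<and> a0 \<in> underS r a \<and> closed_under h a \<and> F x a = c" if "x \<in> X" for x
    using regressive_unbounded_fibre[OF S(1), of h a0 "F x"] regr[OF that] h(1) a0 by metis
  then obtain \<xi> where \<xi>: "\<And>x. x \<in> X \<Longrightarrow> \<xi> x \<in> ?F"
    "\<And>x g. x \<in> X \<Longrightarrow> g \<in> ?F \<Longrightarrow> \<exists>a\<in>S. g \<in> underS r a \<and> a0 \<in> underS r a \<and> closed_under h a \<and> F x a = \<xi> x"
    by metis
  have "inj_on \<xi> X"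
  proof (rule inj_onI, rule ccontr)
    fix x y assume xy: "x \<in> X" "y \<in> X" "\<xi> x = \<xi> y" "x \<noteq> y"
    then obtain b where b: "a0 \<in> underS r b" "F x b \<noteq> F y b" using sep by blast
    then have bF: "b \<in> ?F" using underS_Field by blast
    have Fb: "F x b \<in> underS r b" using regr xy b by blast
    obtain a where a: "a \<in> S" "b \<in> underS r a" "a0 \<in> underS r a" "closed_under h a" "F x a = \<xi> x"
      using \<xi>(2)[OF xy(1) bF] by auto
    \<comment> \<open>\<open>?t\<close> records the value of \<open>x\<close> at \<open>b\<close>.
      It enters \<open>B\<close> at level \<open>a\<close>, so it reappears at a later level
      \<open>a'\<close> where \<open>y\<close> has the same number. The branch \<open>z\<close>
      witnessing it there agrees with \<open>y\<close> at \<open>a'\<close>, hence at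
      \<open>b\<close> by coherence, yet has the value of \<open>x\<close> at
      \<open>b\<close>.\<close>
    let ?t = "p (\<xi> x, b, F x b)"
    have "F x a \<in> underS r a" using regr xy a by blast
    then have t: "?t \<in> underS r a"
      using p_closed[OF a(4)] a(2,5) Fb underS_trans by metis
    moreover have "?t = p (F x a, b, F x b)" using a(5) by simp
    ultimately have "?t \<in> A a"
      unfolding A_def using a(2,3) xy(1) b(1) by blast
    then have "?t \<in> B" using S(2)[OF a(1)] by blast
    have "a \<in> ?F" using a underS_Field by blast
    then obtain a' where a': "a' \<in> S" "a \<in> underS r a'" "a0 \<in> underS r a'" "F y a' = \<xi> y"
      using \<xi>(2)[OF xy(2)] by metis
    have "?t \<in> underS r a'" using t a'(2) underS_trans by blast
    then have "?t \<in> A a'" using S(2)[OF a'(1)] \<open>?t \<in> B\<close> by blast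
    then obtain z b' where z: "?t = p (F z a', b', F z b')" "z \<in> X" "a0 \<in> underS r b'" "b' \<in> underS r a'"
      by (auto simp: A_def)
    have "F z a' \<in> ?F" "F z b' \<in> ?F" "b' \<in> ?F" "F x b \<in> ?F"
      using regr[OF z(2)] a'(3) z Fb underS_Field by blast+
    then have eq: "F z a' = \<xi> x" "b' = b" "F z b' = F x b"
      using inj_onD[OF p(1) z(1)] \<xi>(1)[OF xy(1)] bF by auto
    have "F z b = F y b"
      using coh[OF z(2) xy(2) b(1), of a'] eq xy(3) a'(4) z(4) by auto
    then show False using eq b(2) by simp
  qed
  then show ?thesis using \<xi>(1) unfolding lepoll_def by blast
qed

section \<open>Uniformly continuous functions from chains of neighbourhoods\<close>

lemma sum_list_crossing:
  fixes w :: "'a \<Rightarrow> real"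
  assumes "0 < s" "s \<le> sum_list (map w xs)"
  obtains ys z zs where "xs = ys @ z # zs" "sum_list (map w ys) < s" "s \<le> sum_list (map w ys) + w z"
  using assms(2)
proof (induction xs arbitrary: thesis rule: rev_induct)
  case Nil
  then show ?case using assms(1) by simp
next
  case (snoc x xs)
  show ?case
  proof (cases "s \<le> sum_list (map w xs)")
    case True
    obtain ys z zs where "xs = ys @ z # zs" "sum_list (map w ys) < s" "s \<le> sum_list (map w ys) + w z"
      by (rule snoc.IH[OF _ True])
    then show ?thesis using snoc.prems(1)[of ys z "zs @ [x]"] by simp
  next
    case False
    then show ?thesis using snoc.prems(1)[of xs x "[]"] snoc.prems(2) by simp
  qed
qed

context group
begin

text \<open>As in the Birkhoff-Kakutani construction, a link \<open>x\<close> from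
  \<open>U n\<close> costs \<open>(1/2) ^ n\<close>. The index is part of the link because
  \<open>x\<close> may belong to many \<open>U n\<close> and the cost depends on the choice.\<close>

abbreviation chain_prod :: "(nat \<times> 'a) list \<Rightarrow> 'a"
  where "chain_prod xs \<equiv> foldr (\<lambda>(n, x) y. x \<otimes> y) xs \<one>"

abbreviation chain_length :: "(nat \<times> 'a) list \<Rightarrow> real"
  where "chain_length xs \<equiv> sum_list (map (\<lambda>(n, x). (1/2) ^ n) xs)"

definition chain :: "(nat \<Rightarrow> 'a set) \<Rightarrow> (nat \<times> 'a) list \<Rightarrow> bool"
  where "chain U xs \<longleftrightarrow> (\<forall>(n, x)\<in>set xs. x \<in> U n)"

lemma chain_simps [simp]:
  "chain U []" "chain U ((n, x) # xs) \<longleftrightarrow> x \<in> U n \<and> chain U xs"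
  "chain U (xs @ ys) \<longleftrightarrow> chain U xs \<and> chain U ys"
  by (auto simp: chain_def)

lemma chain_length_nonneg: "0 \<le> chain_length xs"
  by (rule sum_list_nonneg) auto

lemma chain_prod_closed:
  assumes "\<And>n. U n \<subseteq> carrier G" "chain U xs"
  shows "chain_prod xs \<in> carrier G"
  using assms(2) by (induction xs) (auto intro!: m_closed intro: subsetD[OF assms(1)])

lemma chain_prod_append:
  assumes "\<And>n. U n \<subseteq> carrier G" "chain U xs" "chain U ys"
  shows "chain_prod (xs @ ys) = chain_prod xs \<otimes> chain_prod ys"
  using assms(2)
proof (induction xs)
  case Nil
  then show ?case using chain_prod_closed[OF assms(1,3)] by simp
next
  case (Cons a xs)
  obtain n x where a: "a = (n, x)" by force
  have "x \<in> carrier G" "chain_prod xs \<in> carrier G" "chain_prod ys \<in> carrier G"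
    using Cons.prems a assms(1) chain_prod_closed[OF assms(1)] assms(3) by auto
  moreover have "chain_prod (xs @ ys) = chain_prod xs \<otimes> chain_prod ys"
    using Cons a by simp
  ultimately show ?case unfolding a by (simp add: m_assoc)
qed

text \<open>Split a short chain at the link where half of the allowed length is used up: what lies before
  and what lies after it has at most half of that length.\<close>

lemma chain_prod_mem:
  assumes sub: "\<And>n. U n \<subseteq> carrier G" and one: "\<And>n. \<one> \<in> U n"
    and triple: "\<And>n x y z. x \<in> U (Suc n) \<Longrightarrow> y \<in> U (Suc n) \<Longrightarrow> z \<in> U (Suc n) \<Longrightarrow> x \<otimes> (y \<otimes> z) \<in> U n"
    and "chain U xs" "chain_length xs < (1/2) ^ m"
  shows "chain_prod xs \<in> U m"
  using assms(4,5)
proof (induction xs arbitrary: m rule: length_induct)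
  case (1 xs)
  let ?w = "\<lambda>(n, x). (1/2 :: real) ^ n"
  let ?s = "(1/2 :: real) ^ Suc m"
  show ?case
  proof (cases "xs = []")
    case True
    then show ?thesis using one by simp
  next
    case False
    have "\<exists>ys z zs. xs = ys @ z # zs \<and> chain_length ys < ?s \<and> chain_length zs < ?s"
    proof (cases "?s \<le> chain_length xs")
      case True
      obtain ys z zs where *: "xs = ys @ z # zs" "chain_length ys < ?s" "?s \<le> chain_length ys + ?w z"
        by (rule sum_list_crossing[of ?s ?w xs]) (use True in auto)
      \<comment> \<open>The total is below twice \<open>?s\<close> and the links up to
        \<open>z\<close> use at least \<open>?s\<close>, so less than \<open>?s\<close> is
        left.\<close>
      then have "chain_length zs < ?s"
        using "1.prems"(2) by simp
      then show ?thesis using * by blast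
    next
      case False
      \<comment> \<open>The whole chain is shorter than \<open>?s\<close>, so its first link can be
        the middle one, with nothing before it.\<close>
      obtain z zs where "xs = z # zs" using \<open>xs \<noteq> []\<close> by (cases xs) auto
      moreover from this have "chain_length zs < ?s"
        using False by (cases z) (auto simp: not_le intro: le_less_trans[rotated])
      ultimately show ?thesis by (intro exI[of _ "[]"] exI[of _ z] exI[of _ zs]) simp
    qed
    then obtain ys n x zs where xs: "xs = ys @ (n, x) # zs"
      and less: "chain_length ys < ?s" "chain_length zs < ?s" by auto
    have ch: "chain U ys" "x \<in> U n" "chain U zs" using "1.prems"(1) xs by auto
    have mem: "chain_prod ys \<in> U (Suc m)" "chain_prod zs \<in> U (Suc m)"
      using "1.IH" xs less ch by auto
    \<comment> \<open>The middle link costs less than \<open>(1/2) ^ m\<close>, so its index is at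
      least \<open>Suc m\<close>; the sets decrease because \<open>triple\<close> can be applied
      with two identities.\<close>
    have xU: "x \<in> U (Suc m)"
    proof -
      have antimono: "U b \<subseteq> U a" if "a \<le> b" for a b
      proof (rule lift_Suc_antimono_le[OF _ that])
        fix n show "U (Suc n) \<subseteq> U n"
        proof
          fix x assume x: "x \<in> U (Suc n)"
          then have "x \<in> carrier G" using sub by blast
          then show "x \<in> U n" using triple[OF x one one] by simp
        qed
      qed
      have "chain_length xs = chain_length ys + ((1/2) ^ n + chain_length zs)"
        unfolding xs by simp
      then have "(1/2 :: real) ^ n < (1/2) ^ m"
        using "1.prems"(2) chain_length_nonneg[of ys] chain_length_nonneg[of zs] by linarith
      then have "Suc m \<le> n"
        by (simp add: power_strict_decreasing_iff)
      then show ?thesis using antimono ch(2) by blast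
    qed
    have "chain_prod xs = chain_prod ys \<otimes> (x \<otimes> chain_prod zs)"
      unfolding xs using ch chain_prod_append[OF sub ch(1), of "(n, x) # zs"] by simp
    then show ?thesis using triple mem xU by simp
  qed
qed

text \<open>\<open>f\<close> is the infimum of the costs of chains with product \<open>x\<close>,
  capped at 1. Appending a link on the right raises it by at most the cost of that link, and a chain
  of cost below \<open>(1/2) ^ 0\<close> has its product in \<open>U 0\<close>.\<close>

lemma uniformly_continuous_separation:
  assumes sub: "\<And>n. U n \<subseteq> carrier G" and one: "\<And>n. \<one> \<in> U n"
    and inv: "\<And>n x. x \<in> U n \<Longrightarrow> inv x \<in> U n"
    and triple: "\<And>n x y z. x \<in> U (Suc n) \<Longrightarrow> y \<in> U (Suc n) \<Longrightarrow> z \<in> U (Suc n) \<Longrightarrow> x \<otimes> (y \<otimes> z) \<in> U n"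
  obtains f :: "'a \<Rightarrow> real" where "f \<one> = 0"
    "\<And>x. x \<notin> U 0 \<Longrightarrow> f x = 1"
    "\<And>x u n. x \<in> carrier G \<Longrightarrow> u \<in> U n \<Longrightarrow> \<bar>f (x \<otimes> u) - f x\<bar> \<le> (1/2) ^ n"
proof -
  \<comment> \<open>The inserted 1 caps \<open>f\<close> and keeps the set nonempty where no chain
    reaches \<open>x\<close>.\<close>
  define D where "D x = insert 1 {chain_length xs | xs. chain U xs \<and> chain_prod xs = x}" for x
  define f where "f x = Inf (D x)" for x
  have pos: "0 \<le> d" if "d \<in> D x" for d x
    using that chain_length_nonneg by (auto simp: D_def)
  then have bdd: "bdd_below (D x)" for x by (meson bdd_belowI)
  have lower: "f x \<le> d" if "d \<in> D x" for x d
    unfolding f_def using that bdd by (rule cInf_lower)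
  have greatest: "c \<le> f x" if "\<And>d. d \<in> D x \<Longrightarrow> c \<le> d" for x c
    unfolding f_def by (rule cInf_greatest) (use that in \<open>auto simp: D_def\<close>)
  have le1: "f x \<le> 1" for x by (rule lower) (simp add: D_def)
  have step: "f (x \<otimes> u) \<le> f x + (1/2) ^ n" if x: "x \<in> carrier G" and u: "u \<in> U n" for x u n
  proof -
    have "f (x \<otimes> u) - (1/2) ^ n \<le> f x"
    proof (rule greatest)
      fix d assume "d \<in> D x"
      then consider "d = 1" | xs where "d = chain_length xs" "chain U xs" "chain_prod xs = x"
        by (auto simp: D_def)
      then show "f (x \<otimes> u) - (1/2) ^ n \<le> d"
      proof cases
        case 1
        then show ?thesis using le1[of "x \<otimes> u"] by (simp add: add_increasing2 diff_le_eq)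
      next
        case (2 xs)
        have uG: "u \<in> carrier G" using u sub by blast
        have "chain_prod (xs @ [(n, u)]) = x \<otimes> u"
          using chain_prod_append[OF sub 2(2), of "[(n, u)]"] 2(3) u uG by simp
        then have "chain_length (xs @ [(n, u)]) \<in> D (x \<otimes> u)"
          unfolding D_def using 2(2) u by (intro insertI2 CollectI exI[of _ "xs @ [(n, u)]"]) simp
        from lower[OF this] show ?thesis using 2(1) by simp
      qed
    qed
    then show ?thesis by simp
  qed
  show thesis
  proof (rule that)
    have "0 \<in> D \<one>" unfolding D_def by (intro insertI2 CollectI exI[of _ "[]"]) simp
    then show "f \<one> = 0" using lower greatest pos by (meson antisym)
    show "f x = 1" if "x \<notin> U 0" for x
    proof (rule antisym[OF le1 greatest])
      fix d assume "d \<in> D x"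
      then show "1 \<le> d"
        using chain_prod_mem[OF sub one triple, where m = 0] \<open>x \<notin> U 0\<close> by (force simp: D_def not_less)
    qed
    show "\<bar>f (x \<otimes> u) - f x\<bar> \<le> (1/2) ^ n" if x: "x \<in> carrier G" and u: "u \<in> U n" for x u n
    proof -
      have uG: "u \<in> carrier G" using u sub by blast
      \<comment> \<open>Symmetry of \<open>U n\<close> gives the opposite estimate:
        \<open>inv u\<close> leads back from \<open>x \<otimes> u\<close> to \<open>x\<close> at the
        same cost.\<close>
      have "f ((x \<otimes> u) \<otimes> inv u) \<le> f (x \<otimes> u) + (1/2) ^ n"
        using x uG inv[OF u] by (intro step) auto
      moreover have "(x \<otimes> u) \<otimes> inv u = x" using x uG by (simp add: m_assoc)
      ultimately show ?thesis using step[OF x u] by simp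
    qed
  qed
qed

end

section \<open>The Hausdorff group defined by a filter base of neighbourhoods of the identity\<close>

text \<open>The usual axioms for a neighbourhood base of the identity of a group topology. The
  points common to all members form the kernel that is divided out later.\<close>

locale group_filter_base = group G for G :: "'a monoid" (structure) +
  fixes N :: "'a set set"
  assumes nonempty: "N \<noteq> {}"
    and sub_carrier: "V \<in> N \<Longrightarrow> V \<subseteq> carrier G"
    and one_mem: "V \<in> N \<Longrightarrow> \<one> \<in> V"
    and inv_mem: "V \<in> N \<Longrightarrow> x \<in> V \<Longrightarrow> inv x \<in> V"
    and half: "V \<in> N \<Longrightarrow> \<exists>W\<in>N. \<forall>x\<in>W. \<forall>y\<in>W. x \<otimes> y \<in> V"
    and conjugate: "V \<in> N \<Longrightarrow> g \<in> carrier G \<Longrightarrow> \<exists>W\<in>N. \<forall>x\<in>W. g \<otimes> x \<otimes> inv g \<in> V"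
    and directed: "V \<in> N \<Longrightarrow> W \<in> N \<Longrightarrow> \<exists>U\<in>N. U \<subseteq> V \<inter> W"
begin

lemma mem_carrier: "V \<in> N \<Longrightarrow> x \<in> V \<Longrightarrow> x \<in> carrier G"
  using sub_carrier by blast

lemma inv_mult_trans:
  assumes "x \<in> carrier G" "y \<in> carrier G" "z \<in> carrier G"
  shows "(inv x \<otimes> y) \<otimes> (inv y \<otimes> z) = inv x \<otimes> z"
proof -
  have "(inv x \<otimes> y) \<otimes> (inv y \<otimes> z) = inv x \<otimes> ((y \<otimes> inv y) \<otimes> z)"
    using assms by (simp only: m_assoc m_closed inv_closed)
  then show ?thesis using assms by simp
qed

lemma inv_mult_swap: "V \<in> N \<Longrightarrow> x \<in> carrier G \<Longrightarrow> y \<in> carrier G \<Longrightarrow> inv x \<otimes> y \<in> V \<Longrightarrow> inv y \<otimes> x \<in> V"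
  using inv_mem[of V "inv x \<otimes> y"] by (simp add: inv_mult_group)

text \<open>\<open>interior_of_translate x V y\<close>: the point \<open>y\<close> lies in the interior of \<open>x V\<close>.\<close>

definition interior_of_translate :: "'a \<Rightarrow> 'a set \<Rightarrow> 'a \<Rightarrow> bool"
  where "interior_of_translate x V y \<longleftrightarrow> (\<exists>W\<in>N. \<forall>w\<in>W. inv x \<otimes> (y \<otimes> w) \<in> V)"

lemma interior_of_translate_self: "V \<in> N \<Longrightarrow> x \<in> carrier G \<Longrightarrow> interior_of_translate x V x"
  unfolding interior_of_translate_def
  by (rule bexI[of _ V]) (auto simp: m_assoc[symmetric] mem_carrier)

lemma interior_of_translateI:
  assumes "W \<in> N" "\<And>x y. x \<in> W \<Longrightarrow> y \<in> W \<Longrightarrow> x \<otimes> y \<in> V"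
    "x \<in> carrier G" "y \<in> carrier G" "inv x \<otimes> y \<in> W"
  shows "interior_of_translate x V y"
  unfolding interior_of_translate_def
proof (intro bexI[of _ W] ballI)
  fix w assume w: "w \<in> W"
  have "(inv x \<otimes> y) \<otimes> w \<in> V" using assms w by blast
  then show "inv x \<otimes> (y \<otimes> w) \<in> V"
    using assms(3,4) mem_carrier[OF assms(1) w] by (simp add: m_assoc)
qed (fact assms)

lemma interior_of_translateD:
  "interior_of_translate x V y \<Longrightarrow> y \<in> carrier G \<Longrightarrow> inv x \<otimes> y \<in> V"
  unfolding interior_of_translate_def using one_mem by force

text \<open>The members of \<open>N\<close> need not be open in the topology that they generate, so
  openness has to come from the interiors. Halving the room around \<open>y\<close> leaves enough of
  it around each nearby \<open>z\<close>.\<close>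

lemma interior_of_translate_open:
  assumes "interior_of_translate x V y" "x \<in> carrier G" "y \<in> carrier G"
  obtains W where "W \<in> N" "\<And>z. z \<in> carrier G \<Longrightarrow> inv y \<otimes> z \<in> W \<Longrightarrow> interior_of_translate x V z"
proof -
  obtain U where U: "U \<in> N" "\<forall>w\<in>U. inv x \<otimes> (y \<otimes> w) \<in> V"
    using assms(1) unfolding interior_of_translate_def by blast
  obtain W where W: "W \<in> N" "\<forall>u\<in>W. \<forall>v\<in>W. u \<otimes> v \<in> U"
    using half[OF U(1)] by blast
  show thesis
  proof (rule that[OF W(1)])
    fix z assume z: "z \<in> carrier G" "inv y \<otimes> z \<in> W"
    have "inv x \<otimes> (z \<otimes> w) \<in> V" if w: "w \<in> W" for w
    proof -
      have wG: "w \<in> carrier G" using mem_carrier[OF W(1) w] .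
      have "inv x \<otimes> (y \<otimes> ((inv y \<otimes> z) \<otimes> w)) \<in> V" using U(2) W(2) z(2) w by blast
      moreover have "y \<otimes> ((inv y \<otimes> z) \<otimes> w) = z \<otimes> w"
        using assms(3) z(1) wG by (simp flip: m_assoc)
      ultimately show ?thesis by simp
    qed
    then show "interior_of_translate x V z"
      unfolding interior_of_translate_def using W(1) by blast
  qed
qed

lemma kernel_normal: "(\<Inter>N) \<lhd> G"
  unfolding normal_inv_iff
proof (intro conjI ballI)
  show "subgroup (\<Inter>N) G"
  proof (rule subgroupI)
    show "\<Inter>N \<subseteq> carrier G" using nonempty sub_carrier by blast
    show "\<Inter>N \<noteq> {}" using one_mem by blast
    show "inv a \<in> \<Inter>N" if "a \<in> \<Inter>N" for a using that inv_mem by blast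
    show "a \<otimes> b \<in> \<Inter>N" if "a \<in> \<Inter>N" "b \<in> \<Inter>N" for a b
      using that half by (meson InterE InterI)
  qed
  show "g \<otimes> h \<otimes> inv g \<in> \<Inter>N" if "g \<in> carrier G" "h \<in> \<Inter>N" for g h
    using that conjugate by (meson InterE InterI)
qed

end

text \<open>\<open>\<phi>\<close> stands for any naming of the cosets of the kernel. Its open target
  type allows the quotient to be realised on the type for which the smaller instances of
  \<open>BC\<close> are assumed.\<close>

locale group_filter_base_quotient = group_filter_base G N for G :: "'a monoid" (structure) and N +
  fixes \<phi> :: "'a \<Rightarrow> 'b"
  assumes \<phi>_eq_iff: "x \<in> carrier G \<Longrightarrow> y \<in> carrier G \<Longrightarrow> \<phi> x = \<phi> y \<longleftrightarrow> (\<forall>V\<in>N. inv x \<otimes> y \<in> V)"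
begin

abbreviation H :: "'b monoid" where "H \<equiv> image_group \<phi> G"

lemma weak_morphism: "weak_group_morphism \<phi> (\<Inter>N) G"
proof (rule weak_group_morphismsI[OF kernel_normal])
  fix a b assume ab: "a \<in> carrier G" "b \<in> carrier G"
  interpret K: normal "\<Inter>N" G by (rule kernel_normal)
  \<comment> \<open>Weak morphisms compare \<open>a \<otimes> inv b\<close>, while
    \<open>\<phi>_eq_iff\<close> uses \<open>inv a \<otimes> b\<close>; conjugation inside the
    normal kernel exchanges the two.\<close>
  have "a \<otimes> inv b \<in> \<Inter>N \<longleftrightarrow> inv a \<otimes> b \<in> \<Inter>N"
  proof
    assume "a \<otimes> inv b \<in> \<Inter>N"
    then have "inv b \<otimes> (a \<otimes> inv b) \<otimes> b \<in> \<Inter>N"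
      using K.inv_op_closed1[of b] ab by simp
    then have "inv b \<otimes> a \<in> \<Inter>N" using ab by (simp add: m_assoc)
    then have "inv (inv b \<otimes> a) \<in> \<Inter>N" by (rule K.m_inv_closed)
    then show "inv a \<otimes> b \<in> \<Inter>N" using ab by (simp add: inv_mult_group)
  next
    assume "inv a \<otimes> b \<in> \<Inter>N"
    then have "a \<otimes> (inv a \<otimes> b) \<otimes> inv a \<in> \<Inter>N"
      using K.inv_op_closed2[of a] ab by simp
    then have "b \<otimes> inv a \<in> \<Inter>N" using ab by (simp flip: m_assoc)
    then have "inv (b \<otimes> inv a) \<in> \<Inter>N" by (rule K.m_inv_closed)
    then show "a \<otimes> inv b \<in> \<Inter>N" using ab by (simp add: inv_mult_group)
  qed
  then show "\<phi> a = \<phi> b \<longleftrightarrow> a \<otimes> inv b \<in> \<Inter>N"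
    using \<phi>_eq_iff[OF ab] by auto
qed

sublocale \<phi>: group_hom G H \<phi>
  using weak_group_morphism_group_hom[OF weak_morphism] .

lemma carrier_H: "carrier H = \<phi> ` carrier G"
  by (rule image_group_carrier)

text \<open>Openness is decided by translates of members of \<open>N\<close> alone, which is what
  later ties the weight to the size of \<open>N\<close>.\<close>

definition quotient_topology :: "'b topology" where
  "quotient_topology = topology (\<lambda>W. W \<subseteq> \<phi> ` carrier G \<and>
     (\<forall>x\<in>carrier G. \<phi> x \<in> W \<longrightarrow> (\<exists>V\<in>N. \<forall>v\<in>V. \<phi> (x \<otimes> v) \<in> W)))"

lemma openin_quotient_topology:
  "openin quotient_topology W \<longleftrightarrow> W \<subseteq> \<phi> ` carrier G \<and>
     (\<forall>x\<in>carrier G. \<phi> x \<in> W \<longrightarrow> (\<exists>V\<in>N. \<forall>v\<in>V. \<phi> (x \<otimes> v) \<in> W))"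
proof -
  let ?open = "\<lambda>W. W \<subseteq> \<phi> ` carrier G \<and>
     (\<forall>x\<in>carrier G. \<phi> x \<in> W \<longrightarrow> (\<exists>V\<in>N. \<forall>v\<in>V. \<phi> (x \<otimes> v) \<in> W))"
  have "istopology ?open"
    unfolding istopology_def
  proof (intro conjI allI impI)
    fix S T assume S: "?open S" and T: "?open T"
    have "\<exists>V\<in>N. \<forall>v\<in>V. \<phi> (x \<otimes> v) \<in> S \<inter> T" if x: "x \<in> carrier G" "\<phi> x \<in> S \<inter> T" for x
    proof -
      obtain V where "V \<in> N" "\<forall>v\<in>V. \<phi> (x \<otimes> v) \<in> S" using S x by blast
      moreover obtain W where "W \<in> N" "\<forall>v\<in>W. \<phi> (x \<otimes> v) \<in> T" using T x by blast
      moreover obtain U where "U \<in> N" "U \<subseteq> V \<inter> W" using directed calculation by blast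
      ultimately show ?thesis by blast
    qed
    then show "S \<inter> T \<subseteq> \<phi> ` carrier G"
      "\<forall>x\<in>carrier G. \<phi> x \<in> S \<inter> T \<longrightarrow> (\<exists>V\<in>N. \<forall>v\<in>V. \<phi> (x \<otimes> v) \<in> S \<inter> T)"
      using S by auto
  next
    fix K assume K: "\<forall>S\<in>K. ?open S"
    show "\<Union>K \<subseteq> \<phi> ` carrier G" using K by blast
    have "\<exists>V\<in>N. \<forall>v\<in>V. \<phi> (x \<otimes> v) \<in> \<Union>K" if x: "\<phi> x \<in> \<Union>K" "x \<in> carrier G" for x
    proof -
      obtain S where S: "S \<in> K" "\<phi> x \<in> S" using x by blast
      then obtain V where "V \<in> N" "\<forall>v\<in>V. \<phi> (x \<otimes> v) \<in> S" using K x(2) by meson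
      then show ?thesis using S(1) by blast
    qed
    then show "\<forall>x\<in>carrier G. \<phi> x \<in> \<Union>K \<longrightarrow> (\<exists>V\<in>N. \<forall>v\<in>V. \<phi> (x \<otimes> v) \<in> \<Union>K)" by blast
  qed
  then show ?thesis unfolding quotient_topology_def by (simp add: topology_inverse')
qed

lemma topspace_quotient_topology: "topspace quotient_topology = carrier H"
proof -
  have "openin quotient_topology (\<phi> ` carrier G)"
    unfolding openin_quotient_topology using nonempty mem_carrier by blast
  then have "\<phi> ` carrier G \<subseteq> topspace quotient_topology" by (rule openin_subset)
  moreover have "topspace quotient_topology \<subseteq> \<phi> ` carrier G"
    using openin_topspace[of quotient_topology] unfolding openin_quotient_topology by blast
  ultimately show ?thesis by (simp add: carrier_H)
qed

definition nbhd :: "'a \<Rightarrow> 'a set \<Rightarrow> 'b set"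
  where "nbhd x V = \<phi> ` {y \<in> carrier G. interior_of_translate x V y}"

text \<open>Interiors are unions of cosets of the kernel: if \<open>\<phi> z = \<phi> y\<close>,
  then \<open>inv z \<otimes> y\<close> lies in every member of \<open>N\<close>, in particular in
  the room around \<open>z\<close>.\<close>

lemma mem_nbhd_iff:
  assumes "x \<in> carrier G" "y \<in> carrier G"
  shows "\<phi> y \<in> nbhd x V \<longleftrightarrow> interior_of_translate x V y"
proof
  assume "\<phi> y \<in> nbhd x V"
  then obtain z where z: "z \<in> carrier G" "\<phi> z = \<phi> y" "interior_of_translate x V z"
    by (auto simp: nbhd_def)
  obtain W where "W \<in> N" "\<And>u. u \<in> carrier G \<Longrightarrow> inv z \<otimes> u \<in> W \<Longrightarrow> interior_of_translate x V u"
    using interior_of_translate_open[OF z(3) assms(1) z(1)] by metis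
  then show "interior_of_translate x V y"
    using z(2) \<phi>_eq_iff[OF z(1) assms(2)] assms(2) by blast
qed (use assms in \<open>auto simp: nbhd_def\<close>)

lemma nbhd_self: "V \<in> N \<Longrightarrow> x \<in> carrier G \<Longrightarrow> \<phi> x \<in> nbhd x V"
  using mem_nbhd_iff interior_of_translate_self by blast

lemma nbhdE:
  assumes "h \<in> nbhd x V" "x \<in> carrier G"
  obtains y where "y \<in> carrier G" "h = \<phi> y" "inv x \<otimes> y \<in> V"
  using assms interior_of_translateD unfolding nbhd_def by blast

lemma openin_nbhd:
  assumes "x \<in> carrier G"
  shows "openin quotient_topology (nbhd x V)"
  unfolding openin_quotient_topology
proof (intro conjI ballI impI)
  show "nbhd x V \<subseteq> \<phi> ` carrier G" by (auto simp: nbhd_def)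
  fix y assume y: "y \<in> carrier G" "\<phi> y \<in> nbhd x V"
  then have "interior_of_translate x V y" using mem_nbhd_iff assms by blast
  then obtain W where W: "W \<in> N"
    "\<And>z. z \<in> carrier G \<Longrightarrow> inv y \<otimes> z \<in> W \<Longrightarrow> interior_of_translate x V z"
    using interior_of_translate_open assms y(1) by metis
  have "\<phi> (y \<otimes> v) \<in> nbhd x V" if "v \<in> W" for v
  proof -
    have v: "v \<in> carrier G" using mem_carrier[OF W(1) that] .
    then have "interior_of_translate x V (y \<otimes> v)"
      using W(2)[of "y \<otimes> v"] y(1) that by (simp flip: m_assoc)
    then have "y \<otimes> v \<in> {y \<in> carrier G. interior_of_translate x V y}" using v y(1) by simp
    then show ?thesis unfolding nbhd_def by (rule imageI)
  qed
  then show "\<exists>W\<in>N. \<forall>v\<in>W. \<phi> (y \<otimes> v) \<in> nbhd x V" using W(1) by blast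
qed

lemma nbhd_base:
  assumes "openin quotient_topology W" "x \<in> carrier G" "\<phi> x \<in> W"
  obtains V where "V \<in> N" "\<And>v. v \<in> V \<Longrightarrow> \<phi> (x \<otimes> v) \<in> W" "nbhd x V \<subseteq> W"
proof -
  obtain V where V: "V \<in> N" "\<And>v. v \<in> V \<Longrightarrow> \<phi> (x \<otimes> v) \<in> W"
    using assms unfolding openin_quotient_topology by blast
  have "h \<in> W" if h: "h \<in> nbhd x V" for h
  proof -
    obtain y where y: "y \<in> carrier G" "h = \<phi> y" "inv x \<otimes> y \<in> V"
      using nbhdE[OF h assms(2)] .
    have "x \<otimes> (inv x \<otimes> y) = y" using assms(2) y(1) by (simp flip: m_assoc)
    then show ?thesis using V(2)[OF y(3)] y(2) by simp
  qed
  then show thesis using that V by blast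
qed

lemma continuous_mult: "continuous_map (prod_topology quotient_topology quotient_topology) quotient_topology
    (\<lambda>(x, y). x \<otimes>\<^bsub>H\<^esub> y)"
  unfolding continuous_map_def
proof (intro conjI allI impI)
  show "(\<lambda>(x, y). x \<otimes>\<^bsub>H\<^esub> y) \<in> topspace (prod_topology quotient_topology quotient_topology)
      \<rightarrow> topspace quotient_topology"
    by (auto simp: topspace_quotient_topology)
  fix U assume U: "openin quotient_topology U"
  let ?P = "{p \<in> topspace (prod_topology quotient_topology quotient_topology).
              (case p of (x, y) \<Rightarrow> x \<otimes>\<^bsub>H\<^esub> y) \<in> U}"
  show "openin (prod_topology quotient_topology quotient_topology) ?P"
    unfolding openin_prod_topology_alt
  proof (intro allI impI)
    fix a b assume ab: "(a, b) \<in> ?P"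
    then obtain x y where x: "x \<in> carrier G" "a = \<phi> x" and y: "y \<in> carrier G" "b = \<phi> y"
      by (auto simp: topspace_quotient_topology carrier_H)
    then have "\<phi> (x \<otimes> y) \<in> U" using ab by simp
    then obtain V where V: "V \<in> N" "\<And>v. v \<in> V \<Longrightarrow> \<phi> ((x \<otimes> y) \<otimes> v) \<in> U"
      using nbhd_base[OF U m_closed[OF x(1) y(1)]] by metis
    obtain V1 where V1: "V1 \<in> N" "\<forall>u\<in>V1. \<forall>v\<in>V1. u \<otimes> v \<in> V" using half[OF V(1)] by blast
    \<comment> \<open>Moving the increment of the first factor past \<open>y\<close> conjugates it
      by \<open>inv y\<close>: the product \<open>x' y'\<close> is \<open>x y\<close> times
      \<open>inv y (inv x x') y\<close> times \<open>inv y y'\<close>.\<close>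
    obtain V2 where V2: "V2 \<in> N" "\<forall>u\<in>V2. inv y \<otimes> u \<otimes> inv (inv y) \<in> V1"
      using conjugate[OF V1(1), of "inv y"] y by auto
    have "(h, k) \<in> ?P" if h: "h \<in> nbhd x V2" and k: "k \<in> nbhd y V1" for h k
    proof -
      obtain x' where x': "x' \<in> carrier G" "h = \<phi> x'" "inv x \<otimes> x' \<in> V2" using nbhdE[OF h x(1)] .
      obtain y' where y': "y' \<in> carrier G" "k = \<phi> y'" "inv y \<otimes> y' \<in> V1" using nbhdE[OF k y(1)] .
      have "inv y \<otimes> (inv x \<otimes> x') \<otimes> inv (inv y) \<otimes> (inv y \<otimes> y') \<in> V"
        using V1(2) V2(2) x'(3) y'(3) by blast
      moreover have "(x \<otimes> y) \<otimes> (inv y \<otimes> (inv x \<otimes> x') \<otimes> inv (inv y) \<otimes> (inv y \<otimes> y')) = x' \<otimes> y'"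
      proof -
        have cancel: "a \<otimes> (inv a \<otimes> b) = b" if "a \<in> carrier G" "b \<in> carrier G" for a b
          using that by (simp flip: m_assoc)
        show ?thesis using x(1) y(1) x'(1) y'(1) by (simp add: m_assoc cancel)
      qed
      ultimately have "\<phi> (x' \<otimes> y') \<in> U" using V(2) by metis
      then show ?thesis
        using x' y' by (simp add: topspace_quotient_topology carrier_H)
    qed
    then show "\<exists>U V. openin quotient_topology U \<and> openin quotient_topology V \<and> a \<in> U \<and> b \<in> V \<and> U \<times> V \<subseteq> ?P"
      using openin_nbhd[OF x(1), of V2] openin_nbhd[OF y(1), of V1]
        nbhd_self[OF V2(1) x(1)] nbhd_self[OF V1(1) y(1)] x(2) y(2)
      by (intro exI[of _ "nbhd x V2"] exI[of _ "nbhd y V1"]) blast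
  qed
qed

lemma continuous_inverse: "continuous_map quotient_topology quotient_topology (\<lambda>x. inv\<^bsub>H\<^esub> x)"
  unfolding continuous_map_def
proof (intro conjI allI impI)
  show "(\<lambda>x. inv\<^bsub>H\<^esub> x) \<in> topspace quotient_topology \<rightarrow> topspace quotient_topology"
    by (auto simp: topspace_quotient_topology)
  fix U assume U: "openin quotient_topology U"
  let ?P = "{h \<in> topspace quotient_topology. inv\<^bsub>H\<^esub> h \<in> U}"
  show "openin quotient_topology ?P"
    unfolding openin_quotient_topology
  proof (intro conjI ballI impI)
    show "?P \<subseteq> \<phi> ` carrier G" by (auto simp: topspace_quotient_topology carrier_H)
    fix x assume x: "x \<in> carrier G" "\<phi> x \<in> ?P"
    then have "\<phi> (inv x) \<in> U" by simp
    then obtain V where V: "V \<in> N" "\<And>v. v \<in> V \<Longrightarrow> \<phi> (inv x \<otimes> v) \<in> U"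
      using nbhd_base[OF U inv_closed[OF x(1)]] by metis
    \<comment> \<open>The inverse of \<open>x v\<close> is \<open>inv x\<close> times the conjugate
      of \<open>inv v\<close> by \<open>x\<close>, and that conjugate has to land in
      \<open>V\<close>.\<close>
    obtain W where W: "W \<in> N" "\<forall>u\<in>W. x \<otimes> u \<otimes> inv x \<in> V"
      using conjugate[OF V(1) x(1)] by blast
    have "\<phi> (x \<otimes> v) \<in> ?P" if v: "v \<in> W" for v
    proof -
      have vG: "v \<in> carrier G" using mem_carrier[OF W(1) v] .
      have "\<phi> (inv x \<otimes> (x \<otimes> inv v \<otimes> inv x)) \<in> U"
        using V(2) W(2) inv_mem[OF W(1) v] by blast
      moreover have "inv x \<otimes> (x \<otimes> inv v \<otimes> inv x) = inv (x \<otimes> v)"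
        using x(1) vG by (simp add: inv_mult_group flip: m_assoc)
      ultimately have "\<phi> (inv (x \<otimes> v)) \<in> U" by simp
      moreover have "\<phi> (inv (x \<otimes> v)) = inv\<^bsub>H\<^esub> (\<phi> (x \<otimes> v))" using x(1) vG by (intro \<phi>.hom_inv) simp
      moreover have "\<phi> (x \<otimes> v) \<in> topspace quotient_topology"
        unfolding topspace_quotient_topology carrier_H using x(1) vG by blast
      ultimately show ?thesis by simp
    qed
    then show "\<exists>V\<in>N. \<forall>v\<in>V. \<phi> (x \<otimes> v) \<in> ?P" using W(1) by blast
  qed
qed

lemma t1_space_quotient: "t1_space quotient_topology"
  unfolding t1_space_def
proof (intro ballI impI)
  fix a b assume "a \<in> topspace quotient_topology" "b \<in> topspace quotient_topology" "a \<noteq> b"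
  then obtain x y where x: "x \<in> carrier G" "a = \<phi> x" and y: "y \<in> carrier G" "b = \<phi> y" and "\<phi> x \<noteq> \<phi> y"
    by (auto simp: topspace_quotient_topology carrier_H)
  then obtain V where V: "V \<in> N" "inv x \<otimes> y \<notin> V" using \<phi>_eq_iff by blast
  have "b \<notin> nbhd x V"
    using mem_nbhd_iff[OF x(1) y(1)] interior_of_translateD[OF _ y(1)] V(2) y(2) by blast
  then show "\<exists>U. openin quotient_topology U \<and> a \<in> U \<and> b \<notin> U"
    using openin_nbhd[OF x(1), of V] nbhd_self[OF V(1) x(1)] x(2) by blast
qed

text \<open>The function obtained from chains inside \<open>V\<close> is translated to
  \<open>z\<close> and read on representatives. It is constant on cosets of the kernel, since two
  such representatives differ by a link of arbitrarily small cost.\<close>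

lemma completely_regular_quotient: "completely_regular_space quotient_topology"
  unfolding completely_regular_space_alt'
proof (intro allI impI)
  fix S a assume S: "openin quotient_topology S" and a: "a \<in> S"
  then have "a \<in> \<phi> ` carrier G" unfolding openin_quotient_topology by blast
  then obtain z where z: "z \<in> carrier G" "a = \<phi> z" by blast
  obtain V where V: "V \<in> N" "\<And>v. v \<in> V \<Longrightarrow> \<phi> (z \<otimes> v) \<in> S"
    using nbhd_base[OF S z(1)] a z(2) by metis
  have "\<exists>U. U 0 = V \<and> (\<forall>n. U n \<in> N \<and> (\<forall>x\<in>U (Suc n). \<forall>y\<in>U (Suc n). \<forall>z\<in>U (Suc n). x \<otimes> (y \<otimes> z) \<in> U n))"
  proof -
    \<comment> \<open>Two halvings give triple products; \<open>C\<close> lies in \<open>B\<close>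
      because it contains the identity.\<close>
    have "\<exists>W. W \<in> N \<and> (\<forall>x\<in>W. \<forall>y\<in>W. \<forall>z\<in>W. x \<otimes> (y \<otimes> z) \<in> A)" if A: "A \<in> N" for A
    proof -
      obtain B where B: "B \<in> N" "\<forall>x\<in>B. \<forall>y\<in>B. x \<otimes> y \<in> A" using half[OF A] by blast
      obtain C where C: "C \<in> N" "\<forall>x\<in>C. \<forall>y\<in>C. x \<otimes> y \<in> B" using half[OF B(1)] by blast
      have "x \<in> B" if "x \<in> C" for x
        using C(2) that one_mem[OF C(1)] mem_carrier[OF C(1) that] by force
      then show ?thesis using B(2) C by blast
    qed
    then have "\<exists>U. \<forall>n. (U n \<in> N \<and> (n = 0 \<longrightarrow> U n = V)) \<and>
        (\<forall>x\<in>U (Suc n). \<forall>y\<in>U (Suc n). \<forall>z\<in>U (Suc n). x \<otimes> (y \<otimes> z) \<in> U n)"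
      by (intro dependent_nat_choice) (use V(1) in auto)
    then show ?thesis by blast
  qed
  then obtain U where U0: "U 0 = V" and UN: "\<And>n. U n \<in> N"
    and triple: "\<And>n x y z. x \<in> U (Suc n) \<Longrightarrow> y \<in> U (Suc n) \<Longrightarrow> z \<in> U (Suc n) \<Longrightarrow> x \<otimes> (y \<otimes> z) \<in> U n"
    by blast
  obtain f :: "'a \<Rightarrow> real" where f: "f \<one> = 0" "\<And>x. x \<notin> U 0 \<Longrightarrow> f x = 1"
    "\<And>x u n. x \<in> carrier G \<Longrightarrow> u \<in> U n \<Longrightarrow> \<bar>f (x \<otimes> u) - f x\<bar> \<le> (1/2) ^ n"
    by (rule uniformly_continuous_separation[of U])
      (use sub_carrier[OF UN] one_mem[OF UN] inv_mem[OF UN] triple in blast)+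
  define F where "F h = f (inv z \<otimes> inv_into (carrier G) \<phi> h)" for h
  have small: "\<exists>n. (1/2 :: real) ^ n < e" if "0 < e" for e
    using real_arch_pow_inv[OF that, of "1/2"] by auto
  have F: "F (\<phi> y) = f (inv z \<otimes> y)" if y: "y \<in> carrier G" for y
  proof -
    define y' where "y' = inv_into (carrier G) \<phi> (\<phi> y)"
    have y': "y' \<in> carrier G" "\<phi> y = \<phi> y'"
      using y by (auto simp: y'_def inv_into_into f_inv_into_f)
    then have mem: "inv y \<otimes> y' \<in> U n" for n using \<phi>_eq_iff[OF y y'(1)] UN by blast
    have le: "\<bar>f (inv z \<otimes> y') - f (inv z \<otimes> y)\<bar> \<le> (1/2) ^ n" for n
      using f(3)[OF _ mem[of n], of "inv z \<otimes> y"] z(1) y y'(1) by (simp add: inv_mult_trans)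
    have "\<not> 0 < \<bar>f (inv z \<otimes> y') - f (inv z \<otimes> y)\<bar>"
      using small le by (meson not_less)
    then show ?thesis by (simp add: F_def y'_def)
  qed
  have "continuous_map quotient_topology euclideanreal F"
    unfolding continuous_map_def
  proof (intro conjI allI impI)
    fix O' :: "real set" assume "openin euclideanreal O'"
    then have O': "open O'" by simp
    show "openin quotient_topology {h \<in> topspace quotient_topology. F h \<in> O'}"
      unfolding openin_quotient_topology
    proof (intro conjI ballI impI)
      show "{h \<in> topspace quotient_topology. F h \<in> O'} \<subseteq> \<phi> ` carrier G"
        by (auto simp: topspace_quotient_topology carrier_H)
      fix y assume y: "y \<in> carrier G" "\<phi> y \<in> {h \<in> topspace quotient_topology. F h \<in> O'}"
      then obtain e where e: "0 < e" "\<And>t. dist t (F (\<phi> y)) < e \<Longrightarrow> t \<in> O'"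
        using O' unfolding open_dist by blast
      obtain n where n: "(1/2 :: real) ^ n < e" using small[OF e(1)] by blast
      have "\<phi> (y \<otimes> v) \<in> {h \<in> topspace quotient_topology. F h \<in> O'}" if v: "v \<in> U n" for v
      proof -
        have vG: "v \<in> carrier G" using mem_carrier[OF UN v] .
        have "\<bar>F (\<phi> (y \<otimes> v)) - F (\<phi> y)\<bar> \<le> (1/2) ^ n"
          using f(3)[OF _ v, of "inv z \<otimes> y"] z(1) y(1) vG F[of y] F[of "y \<otimes> v"] by (simp add: m_assoc)
        then have "F (\<phi> (y \<otimes> v)) \<in> O'" using e(2) n by (simp add: dist_real_def)
        moreover have "\<phi> (y \<otimes> v) \<in> topspace quotient_topology"
          unfolding topspace_quotient_topology carrier_H using y(1) vG by blast
        ultimately show ?thesis by blast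
      qed
      then show "\<exists>V\<in>N. \<forall>v\<in>V. \<phi> (y \<otimes> v) \<in> {h \<in> topspace quotient_topology. F h \<in> O'}"
        using UN by blast
    qed
  qed simp
  moreover have "F a = 0" using F[OF z(1)] f(1) z by simp
  moreover have "F h = 1" if h: "h \<in> topspace quotient_topology - S" for h
  proof -
    obtain y where y: "y \<in> carrier G" "h = \<phi> y"
      using h by (auto simp: topspace_quotient_topology carrier_H)
    have "z \<otimes> (inv z \<otimes> y) = y" using y(1) z(1) by (simp flip: m_assoc)
    then have "inv z \<otimes> y \<notin> V" using V(2)[of "inv z \<otimes> y"] h y(2) by auto
    then show ?thesis using f(2) U0 F[OF y(1)] y(2) by simp
  qed
  ultimately show "\<exists>F. continuous_map quotient_topology euclideanreal F \<and> F a = 0 \<and>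
      F ` (topspace quotient_topology - S) \<subseteq> {1}" by blast
qed

lemma topological_group_quotient: "topological_group H quotient_topology"
  unfolding topological_group_def
  using image_group_is_group[OF weak_morphism] topspace_quotient_topology continuous_mult
    continuous_inverse completely_regular_quotient t1_space_quotient by blast

end

section \<open>Small bases of the quotient and the size of the image of \<open>X\<close>\<close>

lemma (in group) l_coset_iff:
  assumes "c \<in> carrier G" "x \<in> carrier G" "V \<subseteq> carrier G"
  shows "x \<in> c <# V \<longleftrightarrow> inv c \<otimes> x \<in> V"
proof
  assume "x \<in> c <# V"
  then obtain v where "v \<in> V" "x = c \<otimes> v" by (auto simp: l_coset_def)
  then show "inv c \<otimes> x \<in> V" using assms by (auto simp flip: m_assoc)
next
  assume "inv c \<otimes> x \<in> V"
  moreover have "x = c \<otimes> (inv c \<otimes> x)" using assms by (simp flip: m_assoc)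
  ultimately show "x \<in> c <# V" unfolding l_coset_def by blast
qed

locale covering_filter_base = group_filter_base G N for G :: "'a monoid" (structure) and N +
  fixes c :: "'a set \<Rightarrow> nat \<Rightarrow> 'a"
  assumes c_closed: "V \<in> N \<Longrightarrow> c V n \<in> carrier G"
    and c_cover: "V \<in> N \<Longrightarrow> x \<in> carrier G \<Longrightarrow> \<exists>n. inv (c V n) \<otimes> x \<in> V"
begin

text \<open>Translates of \<open>V2\<close> cover \<open>G\<close>, and enlarging the one that
  contains \<open>x\<close> to \<open>V1\<close> puts \<open>x\<close> into its interior; two points
  of a translate of \<open>V1\<close> differ by an element of \<open>V\<close>. Only the countably
  many centres \<open>c V2 n\<close> occur for each \<open>V2\<close>, which keeps the resulting
  base small.\<close>

lemma translates_base:
  assumes "x \<in> carrier G" "V \<in> N"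
  obtains V1 V2 n where "V1 \<in> N" "V2 \<in> N" "interior_of_translate (c V2 n) V1 x"
    "\<And>y. y \<in> carrier G \<Longrightarrow> interior_of_translate (c V2 n) V1 y \<Longrightarrow> inv x \<otimes> y \<in> V"
proof -
  obtain V1 where V1: "V1 \<in> N" "\<forall>u\<in>V1. \<forall>v\<in>V1. u \<otimes> v \<in> V" using half[OF assms(2)] by blast
  obtain V2 where V2: "V2 \<in> N" "\<forall>u\<in>V2. \<forall>v\<in>V2. u \<otimes> v \<in> V1" using half[OF V1(1)] by blast
  obtain n where n: "inv (c V2 n) \<otimes> x \<in> V2" using c_cover[OF V2(1) assms(1)] by blast
  have cG: "c V2 n \<in> carrier G" using c_closed[OF V2(1)] .
  have int: "interior_of_translate (c V2 n) V1 x"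
    by (rule interior_of_translateI[OF V2(1) _ cG assms(1) n]) (use V2(2) in blast)
  have "inv x \<otimes> y \<in> V" if y: "y \<in> carrier G" "interior_of_translate (c V2 n) V1 y" for y
  proof -
    have "inv (c V2 n) \<otimes> y \<in> V1" using interior_of_translateD[OF y(2,1)] .
    moreover have "inv x \<otimes> c V2 n \<in> V1"
      using inv_mult_swap[OF V1(1) cG assms(1)] interior_of_translateD[OF int assms(1)] by blast
    ultimately have "(inv x \<otimes> c V2 n) \<otimes> (inv (c V2 n) \<otimes> y) \<in> V" using V1(2) by blast
    then show ?thesis using inv_mult_trans[OF assms(1) cG y(1)] by simp
  qed
  then show thesis using that V1(1) V2(1) int by blast
qed

text \<open>The trace of \<open>x\<close> on the base from \<open>translates_base\<close>, which
  determines its coset. Once the triples are embedded into another type, points of the quotient are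
  named by sets over that type.\<close>

definition code :: "'a \<Rightarrow> ('a set \<times> 'a set \<times> nat) set" where
  "code x = {(V2, V1, n). V2 \<in> N \<and> V1 \<in> N \<and> interior_of_translate (c V2 n) V1 x}"

lemma code_subset: "code x \<subseteq> N \<times> N \<times> UNIV"
  by (auto simp: code_def)

lemma code_eq_iff:
  assumes x: "x \<in> carrier G" and y: "y \<in> carrier G"
  shows "code x = code y \<longleftrightarrow> (\<forall>V\<in>N. inv x \<otimes> y \<in> V)"
proof
  assume eq: "code x = code y"
  show "\<forall>V\<in>N. inv x \<otimes> y \<in> V"
  proof
    fix V assume V: "V \<in> N"
    obtain V1 V2 n where *: "V1 \<in> N" "V2 \<in> N" "interior_of_translate (c V2 n) V1 x"
      "\<And>y. y \<in> carrier G \<Longrightarrow> interior_of_translate (c V2 n) V1 y \<Longrightarrow> inv x \<otimes> y \<in> V"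
      using translates_base[OF x V] by metis
    then have "(V2, V1, n) \<in> code x" by (simp add: code_def)
    then have "(V2, V1, n) \<in> code y" using eq by simp
    then show "inv x \<otimes> y \<in> V" using *(4) y by (auto simp: code_def)
  qed
next
  assume eq: "\<forall>V\<in>N. inv x \<otimes> y \<in> V"
  have sub: "code u \<subseteq> code v"
    if u: "u \<in> carrier G" and v: "v \<in> carrier G" and uv: "\<forall>V\<in>N. inv u \<otimes> v \<in> V" for u v
  proof -
    have "interior_of_translate (c V2 n) V1 v"
      if "V2 \<in> N" "interior_of_translate (c V2 n) V1 u" for V2 V1 n
      using interior_of_translate_open[OF that(2) c_closed[OF that(1)] u] uv v by metis
    then show ?thesis by (auto simp: code_def)
  qed
  have "\<forall>V\<in>N. inv y \<otimes> x \<in> V" using eq inv_mult_swap x y by blast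
  then show "code x = code y" using sub eq x y by (intro equalityI) auto
qed

end

text \<open>The base \<open>B\<close> may be larger than the weight. A base of least cardinality is
  therefore taken and copied into \<open>I\<close>, so that a set of that type represents the
  weight.\<close>

lemma has_weight_exists:
  assumes "is_base T B" "B \<lesssim> I"
  obtains L where "L \<subseteq> I" "has_weight T L"
proof -
  have "\<exists>R\<in>card_of ` {B. is_base T B}. \<forall>R'\<in>card_of ` {B. is_base T B}. (R, R') \<in> ordLeq"
    using assms(1) card_of_Card_order by (intro exists_minim_Card_order) blast+
  then obtain B0 where B0: "is_base T B0" "\<And>B. is_base T B \<Longrightarrow> B0 \<lesssim> B"
    by (auto simp: lepoll_iff_card_of)
  then obtain j where j: "inj_on j B0" "j ` B0 \<subseteq> I"
    using lepoll_trans[OF B0(2)[OF assms(1)] assms(2)] unfolding lepoll_def by blast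
  have "B0 \<approx> j ` B0" using j(1) by (auto simp: eqpoll_def bij_betw_def)
  then have "has_weight T (j ` B0)"
    unfolding has_weight_def using B0 eqpoll_imp_lepoll eqpoll_sym lepoll_trans
    unfolding lepoll_iff_card_of[symmetric] by meson
  then show thesis using that j(2) by blast
qed

text \<open>In a T1 space a point is determined by the members of a base that contain it. This
  covers quotients of finite weight, about which the smaller instances of \<open>BC\<close> say
  nothing.\<close>

lemma t1_finite_weight:
  assumes "t1_space T" "has_weight T L" "finite L"
  shows "finite (topspace T)"
proof -
  obtain B where B: "is_base T B" "B \<lesssim> L"
    using assms(2) unfolding has_weight_def lepoll_iff_card_of by blast
  have "finite B" using B(2) assms(3) by (metis finite_surj lepoll_iff)
  have "x = y" if "x \<in> topspace T" "y \<in> topspace T" "{V \<in> B. x \<in> V} = {V \<in> B. y \<in> V}" for x y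
  proof (rule ccontr)
    assume "x \<noteq> y"
    then obtain U where U: "openin T U" "x \<in> U" "y \<notin> U"
      using assms(1) \<open>x \<in> topspace T\<close> \<open>y \<in> topspace T\<close> unfolding t1_space_def by blast
    then obtain V where "V \<in> B" "x \<in> V" "V \<subseteq> U" using B(1) unfolding is_base_def by meson
    then show False using that(3) U(3) by blast
  qed
  then have "inj_on (\<lambda>x. {V \<in> B. x \<in> V}) (topspace T)" by (intro inj_onI) blast
  moreover have "(\<lambda>x. {V \<in> B. x \<in> V}) ` topspace T \<subseteq> Pow B" by blast
  ultimately show ?thesis using \<open>finite B\<close> by (meson finite_Pow_iff inj_on_finite)
qed

text \<open>\<open>E\<close> numbers the image of \<open>X\<close> in the quotient by the kernel of
  \<open>N\<close>. Members of \<open>N\<close> are open for \<open>T\<close>, so both boundedness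
  properties pass to the quotient, whose weight is at most |I|.\<close>

lemma rothberger_image_small:
  fixes G :: "'a monoid" (structure) and I :: "'k set"
  assumes "group_filter_base G N" and bounded: "aleph0_bounded G T" and X: "rothberger_bounded G T X"
    and N_open: "\<And>V. V \<in> N \<Longrightarrow> openin T V"
    and I: "infinite I" "N \<lesssim> I"
    and BC: "\<And>L :: 'k set. infinite L \<Longrightarrow> L \<lesssim> I \<Longrightarrow> BC TYPE('k set) L"
  obtains E :: "'a \<Rightarrow> 'k" where "E ` X \<subseteq> I"
    "\<And>x y. x \<in> X \<Longrightarrow> y \<in> X \<Longrightarrow> E x = E y \<longleftrightarrow> (\<forall>V\<in>N. inv x \<otimes> y \<in> V)"
proof -
  interpret group_filter_base G N by fact
  have X_carrier: "X \<subseteq> carrier G" using X unfolding rothberger_bounded_def by blast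
  have "\<exists>c :: nat \<Rightarrow> 'a. (\<forall>n. c n \<in> carrier G) \<and> (\<forall>x\<in>carrier G. \<exists>n. inv (c n) \<otimes> x \<in> V)" if V: "V \<in> N" for V
  proof -
    obtain C where C: "countable C" "C \<subseteq> carrier G" "carrier G \<subseteq> (\<Union>c\<in>C. c <# V)"
      using bounded N_open[OF V] one_mem[OF V] unfolding aleph0_bounded_def by meson
    have "C \<noteq> {}" using C(3) one_closed by auto
    then have ran: "range (from_nat_into C) = C" using C(1) by (rule range_from_nat_into)
    have "\<exists>n. inv (from_nat_into C n) \<otimes> x \<in> V" if x: "x \<in> carrier G" for x
    proof -
      obtain a where a: "a \<in> C" "x \<in> a <# V" using C(3) x by blast
      then have "inv a \<otimes> x \<in> V" using l_coset_iff[OF _ x sub_carrier[OF V]] C(2) by blast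
      moreover obtain n where "a = from_nat_into C n" using a(1) ran by blast
      ultimately show ?thesis by blast
    qed
    then show ?thesis using ran C(2) by (intro exI[of _ "from_nat_into C"]) blast
  qed
  then obtain c :: "'a set \<Rightarrow> nat \<Rightarrow> 'a" where c: "\<And>V n. V \<in> N \<Longrightarrow> c V n \<in> carrier G"
    "\<And>V x. V \<in> N \<Longrightarrow> x \<in> carrier G \<Longrightarrow> \<exists>n. inv (c V n) \<otimes> x \<in> V"
    by metis
  interpret covering_filter_base G N c
    by unfold_locales (use c in auto)
  have small: "N \<times> N \<times> (UNIV :: nat set) \<lesssim> I"
    using I infinite_le_lepoll by (intro lepoll_Times_infinite) auto
  then obtain j where j: "inj_on j (N \<times> N \<times> (UNIV :: nat set))" "j ` (N \<times> N \<times> UNIV) \<subseteq> I"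
    unfolding lepoll_def by blast
  \<comment> \<open>The injection \<open>j\<close> turns codes into elements of
    \<open>'k set\<close>, the type required by \<open>BC\<close>.\<close>
  define \<phi> where "\<phi> x = j ` code x" for x
  have "\<phi> x = \<phi> y \<longleftrightarrow> code x = code y" for x y
    unfolding \<phi>_def by (intro inj_on_image_eq_iff[OF j(1)] code_subset)
  then interpret Q: group_filter_base_quotient G N \<phi>
    by unfold_locales (simp add: code_eq_iff)
  let ?T = Q.quotient_topology
  let ?B = "(\<lambda>(V2, V1, n). Q.nbhd (c V2 n) V1) ` (N \<times> N \<times> (UNIV :: nat set))"
  have base: "is_base ?T ?B"
    unfolding is_base_def
  proof (intro conjI allI impI)
    show "\<forall>V\<in>?B. openin ?T V" using Q.openin_nbhd c(1) by auto
    fix U h assume U: "openin ?T U \<and> h \<in> U"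
    then obtain x where x: "x \<in> carrier G" "h = \<phi> x"
      using Q.openin_quotient_topology by blast
    obtain V where V: "V \<in> N" "\<And>v. v \<in> V \<Longrightarrow> \<phi> (x \<otimes> v) \<in> U"
      using Q.nbhd_base[of U x] U x by metis
    obtain V1 V2 n where *: "V1 \<in> N" "V2 \<in> N" "interior_of_translate (c V2 n) V1 x"
      "\<And>y. y \<in> carrier G \<Longrightarrow> interior_of_translate (c V2 n) V1 y \<Longrightarrow> inv x \<otimes> y \<in> V"
      using translates_base[OF x(1) V(1)] by metis
    have "\<phi> y \<in> U" if y: "y \<in> carrier G" "interior_of_translate (c V2 n) V1 y" for y
    proof -
      have "x \<otimes> (inv x \<otimes> y) = y" using x(1) y(1) by (simp flip: m_assoc)
      then show ?thesis using V(2)[OF *(4)[OF y]] by simp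
    qed
    then have "Q.nbhd (c V2 n) V1 \<subseteq> U" by (auto simp: Q.nbhd_def)
    moreover have "h \<in> Q.nbhd (c V2 n) V1" using x *(3) by (auto simp: Q.nbhd_def)
    ultimately show "\<exists>V\<in>?B. h \<in> V \<and> V \<subseteq> U" using *(1,2) by force
  qed
  have translate: "\<phi> ` (g <# V) \<subseteq> \<phi> g <#\<^bsub>Q.H\<^esub> U"
    if "g \<in> carrier G" "V \<in> N" "\<And>v. v \<in> V \<Longrightarrow> \<phi> v \<in> U" for g V U
    using that mem_carrier by (force simp: l_coset_def)
  have small_nbhd: "\<exists>V\<in>N. \<forall>v\<in>V. \<phi> v \<in> U" if U: "openin ?T U" "\<one>\<^bsub>Q.H\<^esub> \<in> U" for U
  proof -
    obtain V where V: "V \<in> N" "\<And>v. v \<in> V \<Longrightarrow> \<phi> (\<one> \<otimes> v) \<in> U"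
      using Q.nbhd_base[OF U(1) one_closed] U(2) by (metis Q.\<phi>.hom_one)
    then have "\<forall>v\<in>V. \<phi> v \<in> U" using mem_carrier[OF V(1)] by force
    then show ?thesis using V(1) by blast
  qed
  have "aleph0_bounded Q.H ?T"
    unfolding aleph0_bounded_def
  proof (intro allI impI)
    fix U assume "openin ?T U \<and> \<one>\<^bsub>Q.H\<^esub> \<in> U"
    then obtain V where V: "V \<in> N" "\<And>v. v \<in> V \<Longrightarrow> \<phi> v \<in> U" using small_nbhd by metis
    obtain C where C: "countable C" "C \<subseteq> carrier G" "carrier G \<subseteq> (\<Union>c\<in>C. c <# V)"
      using bounded N_open[OF V(1)] one_mem[OF V(1)] unfolding aleph0_bounded_def by meson
    have "\<phi> x \<in> (\<Union>d\<in>\<phi> ` C. d <#\<^bsub>Q.H\<^esub> U)" if x: "x \<in> carrier G" for x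
    proof -
      obtain g where g: "g \<in> C" "x \<in> g <# V" using C(3) x by blast
      then have "\<phi> x \<in> \<phi> g <#\<^bsub>Q.H\<^esub> U" using translate[OF _ V, of g] C(2) by blast
      then show ?thesis using g(1) by blast
    qed
    then have "carrier Q.H \<subseteq> (\<Union>d\<in>\<phi> ` C. d <#\<^bsub>Q.H\<^esub> U)" unfolding Q.carrier_H by blast
    moreover have "\<phi> ` C \<subseteq> carrier Q.H" unfolding Q.carrier_H using C(2) by blast
    ultimately show "\<exists>C. countable C \<and> C \<subseteq> carrier Q.H \<and> carrier Q.H \<subseteq> (\<Union>c\<in>C. c <#\<^bsub>Q.H\<^esub> U)"
      using countable_image[OF C(1), of \<phi>] by (intro exI[of _ "\<phi> ` C"] conjI)
  qed
  moreover have "rothberger_bounded Q.H ?T (\<phi> ` X)"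
    unfolding rothberger_bounded_def
  proof (intro conjI allI impI)
    show "\<phi> ` X \<subseteq> carrier Q.H" unfolding Q.carrier_H using X_carrier by blast
    fix U :: "nat \<Rightarrow> 'k set set" assume "\<forall>n. openin ?T (U n) \<and> \<one>\<^bsub>Q.H\<^esub> \<in> U n"
    then have "\<forall>n. \<exists>V\<in>N. \<forall>v\<in>V. \<phi> v \<in> U n" using small_nbhd by blast
    then obtain V where V: "\<And>n. V n \<in> N" "\<And>n v. v \<in> V n \<Longrightarrow> \<phi> v \<in> U n" by metis
    have "\<forall>n. openin T (V n) \<and> \<one> \<in> V n" using V(1) N_open one_mem by blast
    then obtain g where g: "\<And>n. g n \<in> carrier G" "X \<subseteq> (\<Union>n. g n <# V n)"
      using X unfolding rothberger_bounded_def by meson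
    have "\<phi> x \<in> (\<Union>n. \<phi> (g n) <#\<^bsub>Q.H\<^esub> U n)" if x: "x \<in> X" for x
    proof -
      obtain n where "x \<in> g n <# V n" using g(2) x by blast
      then have "\<phi> x \<in> \<phi> (g n) <#\<^bsub>Q.H\<^esub> U n" using translate[OF g(1) V, of n n] by blast
      then show ?thesis by blast
    qed
    then have "\<phi> ` X \<subseteq> (\<Union>n. \<phi> (g n) <#\<^bsub>Q.H\<^esub> U n)" by blast
    then show "\<exists>g. (\<forall>n. g n \<in> carrier Q.H) \<and> \<phi> ` X \<subseteq> (\<Union>n. g n <#\<^bsub>Q.H\<^esub> U n)"
      using g(1) by (intro exI[of _ "\<lambda>n. \<phi> (g n)"] conjI allI) (simp_all add: Q.carrier_H)
  qed
  \<comment> \<open>\<open>L\<close> represents the exact weight, which may be smaller than |I|;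
    \<open>BC\<close> is applied at \<open>L\<close> when it is infinite, and a finite
    \<open>L\<close> makes the quotient finite.\<close>
  moreover obtain L where L: "L \<subseteq> I" "has_weight ?T L"
    using has_weight_exists[OF base] lepoll_trans[OF image_lepoll small] by metis
  ultimately have "infinite L \<Longrightarrow> \<phi> ` X \<lesssim> L"
    using BC[OF _ subset_imp_lepoll[OF L(1)]] Q.topological_group_quotient
    unfolding BC_def lepoll_iff_card_of by blast
  moreover have "finite L \<Longrightarrow> \<phi> ` X \<lesssim> I"
    using t1_finite_weight[OF Q.t1_space_quotient L(2)] X_carrier finite_lepoll_infinite[OF I(1)]
    unfolding Q.topspace_quotient_topology Q.carrier_H by (meson finite_subset image_mono)
  ultimately have "\<phi> ` X \<lesssim> I"
    using L(1) lepoll_trans subset_imp_lepoll by blast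
  then obtain e where e: "inj_on e (\<phi> ` X)" "e ` \<phi> ` X \<subseteq> I" unfolding lepoll_def by blast
  show thesis
  proof (rule that[of "e \<circ> \<phi>"])
    show "(e \<circ> \<phi>) ` X \<subseteq> I" using e(2) by auto
    fix x y assume xy: "x \<in> X" "y \<in> X"
    then have "(e \<circ> \<phi>) x = (e \<circ> \<phi>) y \<longleftrightarrow> \<phi> x = \<phi> y" using e(1) by (auto simp: inj_on_def)
    then show "(e \<circ> \<phi>) x = (e \<circ> \<phi>) y \<longleftrightarrow> (\<forall>V\<in>N. inv x \<otimes> y \<in> V)"
      using Q.\<phi>_eq_iff xy X_carrier by (metis subsetD)
  qed
qed

section \<open>Small filter bases of symmetric neighbourhoods\<close>

text \<open>A single format for all closure steps: a unary operation ignores its second argument,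
  and the index \<open>n\<close> makes room for countably many conjugates.\<close>

inductive_set generated :: "(nat \<Rightarrow> 's \<Rightarrow> 's \<Rightarrow> 's) \<Rightarrow> 's set \<Rightarrow> 's set" for op A where
  base: "x \<in> A \<Longrightarrow> x \<in> generated op A"
| step: "x \<in> generated op A \<Longrightarrow> y \<in> generated op A \<Longrightarrow> op n x y \<in> generated op A"

lemma generated_mono:
  assumes "A \<subseteq> B" shows "generated op A \<subseteq> generated op B"
proof
  fix x assume "x \<in> generated op A"
  then show "x \<in> generated op B"
    by induction (use assms in \<open>auto intro: generated.intros\<close>)
qed

lemma generated_lepoll:
  assumes I: "infinite I" and A: "A \<lesssim> I"
  shows "generated op A \<lesssim> I"
proof -
  \<comment> \<open>Index 0 is reserved for keeping \<open>x\<close>, which makes the stages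
    \<open>L n\<close> increase; hence the shift \<open>k - 1\<close>.\<close>
  define f where "f p = (case p of (k, x, y) \<Rightarrow> if k = 0 then x else op (k - 1) x y)" for p
  define L where "L = rec_nat A (\<lambda>_ B. f ` (UNIV \<times> B \<times> B))"
  have L0: "L 0 = A" and LS: "L (Suc n) = f ` (UNIV \<times> L n \<times> L n)" for n
    by (simp_all add: L_def)
  have "L n \<lesssim> I" for n
  proof (induction n)
    case (Suc n)
    then have "(UNIV :: nat set) \<times> L n \<times> L n \<lesssim> I"
      using I infinite_le_lepoll by (intro lepoll_Times_infinite) auto
    then show ?case unfolding LS using image_lepoll lepoll_trans by blast
  qed (simp add: L0 A)
  then have "(\<Union>n. L n) \<lesssim> I"
    using I infinite_le_lepoll by (intro lepoll_UNION_infinite) auto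
  moreover have "generated op A \<subseteq> (\<Union>n. L n)"
  proof
    have "L n \<subseteq> L (Suc n)" for n
    proof
      fix x assume "x \<in> L n"
      then have "f (0, x, x) \<in> L (Suc n)" unfolding LS by blast
      then show "x \<in> L (Suc n)" by (simp add: f_def)
    qed
    then have mono: "L m \<subseteq> L n" if "m \<le> n" for m n using that by (rule lift_Suc_mono_le)
    fix x assume "x \<in> generated op A"
    then show "x \<in> (\<Union>n. L n)"
    proof induction
      case (base x)
      then show ?case using L0 by blast
    next
      case (step x y k)
      then obtain m n where "x \<in> L m" "y \<in> L n" by blast
      then have "x \<in> L (max m n)" "y \<in> L (max m n)"
        using mono[of m "max m n"] mono[of n "max m n"] by auto
      then have "f (Suc k, x, y) \<in> L (Suc (max m n))" unfolding LS by blast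
      then show ?case by (auto simp: f_def)
    qed
  qed
  ultimately show ?thesis using lepoll_trans subset_imp_lepoll by blast
qed

section \<open>Symmetric neighbourhoods of the identity in a Tychonoff group\<close>

locale tychonoff_group = group G for G :: "'a monoid" (structure) +
  fixes T :: "'a topology"
  assumes topological: "topological_group G T"
begin

lemma topspace_T: "topspace T = carrier G"
  using topological by (simp add: topological_group_def)

lemma open_carrier: "openin T V \<Longrightarrow> x \<in> V \<Longrightarrow> x \<in> carrier G"
  using openin_subset topspace_T by blast

lemma continuous_inv: "continuous_map T T (\<lambda>x. inv x)"
  using topological by (simp add: topological_group_def)

lemma continuous_mult: "continuous_map (prod_topology T T) T (\<lambda>(x, y). x \<otimes> y)"
  using topological by (simp add: topological_group_def)

definition symmetric_nbhds :: "'a set set" where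
  "symmetric_nbhds = {V. openin T V \<and> \<one> \<in> V \<and> (\<forall>x\<in>V. inv x \<in> V)}"

lemma symmetric_nbhd_exists:
  assumes "openin T U" "\<one> \<in> U"
  obtains V where "V \<in> symmetric_nbhds" "V \<subseteq> U"
proof
  let ?V = "U \<inter> {x \<in> topspace T. inv x \<in> U}"
  have "openin T {x \<in> topspace T. inv x \<in> U}"
    using continuous_inv assms(1) unfolding continuous_map_def by blast
  then have "openin T ?V" using assms(1) by blast
  then show "?V \<in> symmetric_nbhds"
    using assms(2) by (auto simp: symmetric_nbhds_def topspace_T)
qed blast

lemma symmetric_nbhds_Int:
  "V \<in> symmetric_nbhds \<Longrightarrow> W \<in> symmetric_nbhds \<Longrightarrow> V \<inter> W \<in> symmetric_nbhds"
  by (auto simp: symmetric_nbhds_def)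

lemma carrier_symmetric_nbhd: "carrier G \<in> symmetric_nbhds"
  using openin_topspace[of T] by (auto simp: symmetric_nbhds_def topspace_T)

lemma symmetric_nbhd_half:
  assumes "V \<in> symmetric_nbhds"
  shows "\<exists>W\<in>symmetric_nbhds. \<forall>x\<in>W. \<forall>y\<in>W. x \<otimes> y \<in> V"
proof -
  have V: "openin T V" "\<one> \<in> V" using assms by (auto simp: symmetric_nbhds_def)
  let ?P = "{p \<in> topspace (prod_topology T T). (case p of (x, y) \<Rightarrow> x \<otimes> y) \<in> V}"
  have "openin (prod_topology T T) ?P"
    using continuous_mult V(1) unfolding continuous_map_def by blast
  moreover have "(\<one>, \<one>) \<in> ?P" using V(2) by (simp add: topspace_T)
  ultimately have "\<exists>A B. openin T A \<and> openin T B \<and> \<one> \<in> A \<and> \<one> \<in> B \<and> A \<times> B \<subseteq> ?P"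
    unfolding openin_prod_topology_alt by (elim allE impE)
  then obtain A B where AB: "openin T A" "openin T B" "\<one> \<in> A" "\<one> \<in> B" "A \<times> B \<subseteq> ?P"
    by blast
  have "openin T (A \<inter> B)" "\<one> \<in> A \<inter> B" using AB by auto
  then obtain W where W: "W \<in> symmetric_nbhds" "W \<subseteq> A \<inter> B" using symmetric_nbhd_exists by metis
  have "x \<otimes> y \<in> V" if "x \<in> W" "y \<in> W" for x y
  proof -
    have "(x, y) \<in> ?P" using AB(5) W(2) that by blast
    then show ?thesis by simp
  qed
  then show ?thesis using W(1) by blast
qed

lemma continuous_conjugation:
  assumes a: "a \<in> carrier G" and b: "b \<in> carrier G"
  shows "continuous_map T T (\<lambda>x. a \<otimes> x \<otimes> b)"
proof -
  have mult: "continuous_map T T (\<lambda>x. f x \<otimes> g x)"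
    if "continuous_map T T f" "continuous_map T T g" for f g
  proof -
    have "continuous_map T (prod_topology T T) (\<lambda>x. (f x, g x))"
      using that by (simp add: continuous_map_pairedI)
    from continuous_map_compose[OF this continuous_mult] show ?thesis by (simp add: o_def)
  qed
  have "continuous_map T T (\<lambda>x. a)" "continuous_map T T (\<lambda>x. b)" "continuous_map T T (\<lambda>x. x)"
    using a b by (simp_all add: topspace_T)
  then show ?thesis by (intro mult)
qed

text \<open>With \<open>W W W \<subseteq> V\<close> and \<open>G = \<Union>n. c n W\<close>, the sets \<open>c n W (c n)\<inverse>\<close> do the job for \<open>V\<close>:
  if \<open>g\<inverse> = c n w\<close>, conjugation by \<open>g\<close> maps \<open>c n W (c n)\<inverse>\<close> into \<open>w\<inverse> W w\<close>.\<close>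

lemma symmetric_nbhd_conjugates:
  assumes bounded: "aleph0_bounded G T" and V: "V \<in> symmetric_nbhds"
  shows "\<exists>k :: nat \<Rightarrow> 'a set. (\<forall>n. k n \<in> symmetric_nbhds) \<and>
    (\<forall>g\<in>carrier G. \<exists>n. \<forall>x\<in>k n. g \<otimes> x \<otimes> inv g \<in> V)"
proof -
  obtain V1 where V1: "V1 \<in> symmetric_nbhds" "\<forall>x\<in>V1. \<forall>y\<in>V1. x \<otimes> y \<in> V"
    using symmetric_nbhd_half[OF V] by blast
  obtain W where W: "W \<in> symmetric_nbhds" "\<forall>x\<in>W. \<forall>y\<in>W. x \<otimes> y \<in> V1"
    using symmetric_nbhd_half[OF V1(1)] by blast
  have Wo: "openin T W" "\<one> \<in> W" "\<And>x. x \<in> W \<Longrightarrow> inv x \<in> W"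
    using W(1) by (auto simp: symmetric_nbhds_def)
  have WG: "x \<in> carrier G" if "x \<in> W" for x using open_carrier[OF Wo(1) that] .
  have WV1: "x \<in> V1" if "x \<in> W" for x
    using W(2) Wo(2) that WG[OF that] by force
  obtain C where C: "countable C" "C \<subseteq> carrier G" "carrier G \<subseteq> (\<Union>c\<in>C. c <# W)"
    using bounded Wo(1,2) unfolding aleph0_bounded_def by meson
  have "C \<noteq> {}" using C(3) one_closed by auto
  then have ran: "range (from_nat_into C) = C" using C(1) by (rule range_from_nat_into)
  define K where "K a = {x \<in> carrier G. inv a \<otimes> x \<otimes> a \<in> W}" for a
  have K: "K a \<in> symmetric_nbhds" if a: "a \<in> C" for a
  proof -
    have aG: "a \<in> carrier G" using a C(2) by blast
    have "openin T (K a)"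
      using continuous_conjugation[of "inv a" a] aG Wo(1)
      unfolding continuous_map_def K_def topspace_T by auto
    moreover have "\<one> \<in> K a" using aG Wo(2) by (simp add: K_def)
    moreover have "inv x \<in> K a" if "x \<in> K a" for x
    proof -
      have x: "x \<in> carrier G" "inv a \<otimes> x \<otimes> a \<in> W" using that by (auto simp: K_def)
      have "inv (inv a \<otimes> x \<otimes> a) = inv a \<otimes> inv x \<otimes> a"
        using aG x(1) by (simp add: inv_mult_group m_assoc)
      then show ?thesis using Wo(3)[OF x(2)] x(1) by (simp add: K_def)
    qed
    ultimately show ?thesis by (simp add: symmetric_nbhds_def)
  qed
  have "\<exists>a\<in>C. \<forall>x\<in>K a. g \<otimes> x \<otimes> inv g \<in> V" if g: "g \<in> carrier G" for g
  proof -
    obtain a where a: "a \<in> C" "inv g \<in> a <# W" using C(3) inv_closed[OF g] by blast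
    then obtain w where w: "w \<in> W" "inv g = a \<otimes> w" by (auto simp: l_coset_def)
    have aG: "a \<in> carrier G" using a C(2) by blast
    have "g = inv w \<otimes> inv a"
      using w(2) g aG WG[OF w(1)] by (metis inv_inv inv_mult_group)
    then have "g \<otimes> x \<otimes> inv g = inv w \<otimes> ((inv a \<otimes> x \<otimes> a) \<otimes> w)" if "x \<in> carrier G" for x
      using w aG WG[OF w(1)] that by (simp add: m_assoc inv_mult_group)
    moreover have "inv w \<otimes> ((inv a \<otimes> x \<otimes> a) \<otimes> w) \<in> V" if "x \<in> K a" for x
      using V1(2) W(2) WV1 Wo(3)[OF w(1)] w(1) that by (simp add: K_def)
    ultimately show ?thesis using a(1) by (auto simp: K_def)
  qed
  moreover have "a \<in> range (from_nat_into C)" if "a \<in> C" for a using ran that by simp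
  moreover have "K (from_nat_into C n) \<in> symmetric_nbhds" for n
    using K from_nat_into[OF \<open>C \<noteq> {}\<close>] by blast
  ultimately show ?thesis
    by (intro exI[of _ "\<lambda>n. K (from_nat_into C n)"]) blast
qed

text \<open>Halves and conjugates are selected for every symmetric neighbourhood before
  \<open>A\<close> is given. One \<open>op\<close> therefore serves all levels, and a larger
  \<open>A\<close> yields a larger filter base.\<close>

lemma filter_base_operations:
  assumes bounded: "aleph0_bounded G T"
  obtains op :: "nat \<Rightarrow> 'a set \<Rightarrow> 'a set \<Rightarrow> 'a set" where
    "\<And>A. A \<noteq> {} \<Longrightarrow> A \<subseteq> symmetric_nbhds \<Longrightarrow>
       group_filter_base G (generated op A) \<and> generated op A \<subseteq> symmetric_nbhds"
proof -
  obtain h where h: "\<And>V. V \<in> symmetric_nbhds \<Longrightarrow> h V \<in> symmetric_nbhds"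
    "\<And>V x y. V \<in> symmetric_nbhds \<Longrightarrow> x \<in> h V \<Longrightarrow> y \<in> h V \<Longrightarrow> x \<otimes> y \<in> V"
    using symmetric_nbhd_half by metis
  obtain k :: "'a set \<Rightarrow> nat \<Rightarrow> 'a set" where k: "\<And>V n. V \<in> symmetric_nbhds \<Longrightarrow> k V n \<in> symmetric_nbhds"
    "\<And>V g. V \<in> symmetric_nbhds \<Longrightarrow> g \<in> carrier G \<Longrightarrow> \<exists>n. \<forall>x\<in>k V n. g \<otimes> x \<otimes> inv g \<in> V"
    using symmetric_nbhd_conjugates[OF bounded] by metis
  define op where
    "op n V W = (if n = 0 then V \<inter> W else if n = 1 then h V else k V (n - 2))" for n and V W :: "'a set"
  have "group_filter_base G (generated op A) \<and> generated op A \<subseteq> symmetric_nbhds"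
    if A: "A \<noteq> {}" "A \<subseteq> symmetric_nbhds" for A
  proof -
    have gen: "V \<in> symmetric_nbhds" if "V \<in> generated op A" for V
      using that by induction (use A(2) in \<open>auto simp: op_def symmetric_nbhds_Int h(1) k(1)\<close>)
    have steps: "V \<inter> W \<in> generated op A" "h V \<in> generated op A" "k V n \<in> generated op A"
      if "V \<in> generated op A" "W \<in> generated op A" for V W n
      using generated.step[OF that, of 0] generated.step[OF that, of 1] generated.step[OF that, of "n + 2"]
      by (simp_all add: op_def)
    have "group_filter_base G (generated op A)"
    proof
      show "generated op A \<noteq> {}" using A(1) generated.base by fast
      fix V assume V: "V \<in> generated op A"
      show "V \<subseteq> carrier G" "\<one> \<in> V" "\<And>x. x \<in> V \<Longrightarrow> inv x \<in> V"
        using gen[OF V] open_carrier by (auto simp: symmetric_nbhds_def)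
      show "\<exists>W\<in>generated op A. \<forall>x\<in>W. \<forall>y\<in>W. x \<otimes> y \<in> V"
        using steps(2)[OF V V] h(2)[OF gen[OF V]] by blast
      show "\<exists>W\<in>generated op A. \<forall>x\<in>W. g \<otimes> x \<otimes> inv g \<in> V" if "g \<in> carrier G" for g
        using steps(3)[OF V V] k(2)[OF gen[OF V] that] by blast
      show "\<exists>U\<in>generated op A. U \<subseteq> V \<inter> W" if "W \<in> generated op A" for W
        using steps(1)[OF V that] by blast
    qed
    then show ?thesis using gen by blast
  qed
  then show thesis using that by blast
qed

lemma separating_symmetric_nbhds:
  assumes "has_weight T L"
  obtains U where "\<And>b. U b \<in> symmetric_nbhds"
    "\<And>z. z \<in> carrier G \<Longrightarrow> z \<noteq> \<one> \<Longrightarrow> \<exists>b\<in>L. z \<notin> U b"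
proof -
  obtain B where B: "is_base T B" "B \<lesssim> L"
    using assms unfolding has_weight_def lepoll_iff_card_of by blast
  obtain g where g: "B \<subseteq> g ` L" using B(2) unfolding lepoll_iff by blast
  \<comment> \<open>\<open>g\<close> covers \<open>B\<close> but may also take other values; where
    \<open>g b\<close> is not a basic neighbourhood of the identity, the whole carrier serves as a
    default.\<close>
  have "\<exists>V. V \<in> symmetric_nbhds \<and> (g b \<in> B \<and> \<one> \<in> g b \<longrightarrow> V \<subseteq> g b)" for b
  proof (cases "g b \<in> B \<and> \<one> \<in> g b")
    case True
    then have "openin T (g b)" using B(1) unfolding is_base_def by blast
    then show ?thesis using symmetric_nbhd_exists True by metis
  qed (use carrier_symmetric_nbhd in blast)
  then obtain U where U: "\<And>b. U b \<in> symmetric_nbhds"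
    "\<And>b. g b \<in> B \<Longrightarrow> \<one> \<in> g b \<Longrightarrow> U b \<subseteq> g b" by metis
  have "\<exists>b\<in>L. z \<notin> U b" if z: "z \<in> carrier G" "z \<noteq> \<one>" for z
  proof -
    have "t1_space T" using topological by (simp add: topological_group_def)
    then obtain W where W: "openin T W" "\<one> \<in> W" "z \<notin> W"
      using z unfolding t1_space_def topspace_T by (metis one_closed)
    obtain V where V: "V \<in> B" "\<one> \<in> V" "V \<subseteq> W"
      using B(1) W unfolding is_base_def by meson
    obtain b where b: "b \<in> L" "V = g b" using g V(1) by blast
    have "z \<notin> U b" using U(2)[of b] b V W(3) by blast
    then show ?thesis using b(1) by blast
  qed
  then show thesis using that U(1) by blast
qed

end

section \<open>The tree of quotients and the conclusion at \<open>\<kappa>\<close>\<close>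

theorem theorem15:
  fixes r :: "'k rel"
  assumes "ineffable r"
    and "\<forall>L :: 'k set. infinite L \<and> (card_of L, r) \<in> ordLess \<longrightarrow> BC TYPE('k set) L"
  shows "BC TYPE('g) (Field r)"
  unfolding BC_def
proof (intro allI impI)
  fix G :: "'g monoid" and T X
  assume *: "topological_group G T \<and> aleph0_bounded G T \<and> has_weight T (Field r) \<and> rothberger_bounded G T X"
  interpret regular_cardinal r
    using assms(1) by unfold_locales (auto simp: ineffable_def)
  interpret group G using * by (simp add: topological_group_def)
  interpret tychonoff_group G T using * by unfold_locales blast
  have X: "X \<subseteq> carrier G" using * unfolding rothberger_bounded_def by blast
  obtain op where op: "\<And>A. A \<noteq> {} \<Longrightarrow> A \<subseteq> symmetric_nbhds \<Longrightarrow>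
       group_filter_base G (generated op A) \<and> generated op A \<subseteq> symmetric_nbhds"
    using filter_base_operations * by blast
  obtain U where U: "\<And>b. U b \<in> symmetric_nbhds"
    "\<And>z. z \<in> carrier G \<Longrightarrow> z \<noteq> \<one>\<^bsub>G\<^esub> \<Longrightarrow> \<exists>b\<in>Field r. z \<notin> U b"
    using separating_symmetric_nbhds[of "Field r"] * by blast
  define N where "N a = generated op (U ` underS r a)" for a
  \<comment> \<open>Levels above \<open>a0\<close> have infinitely many predecessors, so closing
    under countably many operations stays within their number.\<close>
  obtain a0 where a0: "a0 \<in> Field r" "infinite (underS r a0)" using infinite_underS_exists .
  have "\<exists>E :: 'g \<Rightarrow> 'k. E ` X \<subseteq> underS r a \<and>
      (\<forall>x\<in>X. \<forall>y\<in>X. E x = E y \<longleftrightarrow> (\<forall>V\<in>N a. inv\<^bsub>G\<^esub> x \<otimes>\<^bsub>G\<^esub> y \<in> V))" if a: "a0 \<in> underS r a" for a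
  proof -
    have aF: "a \<in> Field r" using a underS_Field by blast
    have "underS r a0 \<subseteq> underS r a" using a underS_trans by blast
    then have inf: "infinite (underS r a)" using a0(2) finite_subset by blast
    then have "U ` underS r a \<noteq> {}" by auto
    moreover have "U ` underS r a \<subseteq> symmetric_nbhds" using U(1) by blast
    ultimately have "group_filter_base G (N a) \<and> N a \<subseteq> symmetric_nbhds"
      unfolding N_def by (rule op)
    then have N: "group_filter_base G (N a)" "N a \<subseteq> symmetric_nbhds" by auto
    have "N a \<lesssim> underS r a"
      unfolding N_def using inf image_lepoll by (rule generated_lepoll)
    moreover have "BC TYPE('k set) L" if "infinite L" "L \<lesssim> underS r a" for L :: "'k set"
      using assms(2) that lepoll_underS_less[OF aF] by blast
    moreover have "openin T V" if "V \<in> N a" for V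
      using N(2) that by (auto simp: symmetric_nbhds_def)
    ultimately obtain E :: "'g \<Rightarrow> 'k" where "E ` X \<subseteq> underS r a"
      "\<And>x y. x \<in> X \<Longrightarrow> y \<in> X \<Longrightarrow> E x = E y \<longleftrightarrow> (\<forall>V\<in>N a. inv\<^bsub>G\<^esub> x \<otimes>\<^bsub>G\<^esub> y \<in> V)"
      using rothberger_image_small[OF N(1), of T X "underS r a"] * inf by metis
    then show ?thesis by blast
  qed
  then obtain E :: "'k \<Rightarrow> 'g \<Rightarrow> 'k" where E: "\<And>a. a0 \<in> underS r a \<Longrightarrow> E a ` X \<subseteq> underS r a"
    "\<And>a x y. a0 \<in> underS r a \<Longrightarrow> x \<in> X \<Longrightarrow> y \<in> X \<Longrightarrow>
       E a x = E a y \<longleftrightarrow> (\<forall>V\<in>N a. inv\<^bsub>G\<^esub> x \<otimes>\<^bsub>G\<^esub> y \<in> V)"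
    by metis
  have "X \<lesssim> Field r"
  proof (rule ineffable_thin_branches[OF assms(1) a0(1), of X "\<lambda>x a. E a x"])
    show "E a x \<in> underS r a" if "x \<in> X" "a0 \<in> underS r a" for x a
      using E(1) that by blast
    show "E b x = E b y" if "x \<in> X" "y \<in> X" "a0 \<in> underS r b" "b \<in> underS r a" "E a x = E a y" for x y a b
    proof -
      \<comment> \<open>Equal numbers at \<open>a\<close> mean equality modulo \<open>N a\<close>,
        which is finer than equality modulo \<open>N b\<close>.\<close>
      have "N b \<subseteq> N a"
        unfolding N_def using that(4) underS_trans by (intro generated_mono image_mono) blast
      moreover have "a0 \<in> underS r a" using that(3,4) by (rule underS_trans)
      ultimately show ?thesis using E(2) that by blast
    qed
    show "\<exists>a. a0 \<in> underS r a \<and> E a x \<noteq> E a y" if xy: "x \<in> X" "y \<in> X" "x \<noteq> y" for x y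
    proof -
      have xyG: "x \<in> carrier G" "y \<in> carrier G" using xy X by auto
      then have "y = x \<otimes>\<^bsub>G\<^esub> (inv\<^bsub>G\<^esub> x \<otimes>\<^bsub>G\<^esub> y)" by (simp flip: m_assoc)
      then have "inv\<^bsub>G\<^esub> x \<otimes>\<^bsub>G\<^esub> y \<noteq> \<one>\<^bsub>G\<^esub>" using xy(3) xyG(1) by force
      moreover have "inv\<^bsub>G\<^esub> x \<otimes>\<^bsub>G\<^esub> y \<in> carrier G" using xyG by simp
      ultimately obtain b where b: "b \<in> Field r" "inv\<^bsub>G\<^esub> x \<otimes>\<^bsub>G\<^esub> y \<notin> U b" using U(2) by blast
      \<comment> \<open>The separating \<open>U b\<close> is a generator at every level above
        \<open>b\<close>; staying above \<open>a0\<close> as well keeps to the levels where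
        \<open>E\<close> is controlled.\<close>
      obtain a where a: "a \<in> Field r" "{a0, b} \<subseteq> underS r a"
        using finite_strict_upper_bound[of "{a0, b}"] a0(1) b(1) by auto
      then have "U b \<in> N a" unfolding N_def by (intro generated.base) blast
      then show ?thesis using E(2)[of a x y] xy(1,2) a(2) b(2) by auto
    qed
  qed
  then show "(card_of X, card_of (Field r)) \<in> ordLeq"
    by (simp add: lepoll_iff_card_of)
qed

end
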